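(* Let $K$ be a field, let $g_2,g_3\in K$, and let $$\phi(x,y,z)=y^2z-4x^3+g_2xz^2+g_3z^3$$ define a smooth plane curve $C_\phi$. Then for all $t,d\in\overline{K}$ with $d^2=4t^3-g_2t-g_3$, $$\phi(x,y,z)=\det\begin{pmatrix} 2x+tz & y+dz & (3t^2-g_2)z\\ 0 & x-tz & y-dz\\ z & 0 & -2x-tz\end{pmatrix}.$$ Moreover, when $K=\mathbb{C}$, let $\Lambda=\omega_1\mathbb{Z}+\omega_2\mathbb{Z}$ (with $\operatorname{Im}(\omega_2/\omega_1)>0$) be the lattice of the Weierstrass parametrization of $C_\phi$, i.e. the lattice with $g_2=60\sum_{\omega\in\Lambda\setminus\{0\}}\omega^{-4}$ and $g_3=140\sum_{\omega\in\Lambda\setminus\{0\}}\omega^{-6}$, let $\tau=\omega_2/\omega_1$ and $a=\theta_2(0,\tau)$, $b=\theta_3(0,\tau)$, $c=\theta_4(0,\tau)$. Then $$\phi(x,y,z)=\det\begin{pmatrix} 2x-\frac{\pi^2}{3\omega_1^2}(a^4+b^4)z & y & -\left(\frac{\pi}{\omega_1}\right)^4c^8z\\ 0 & x+\frac{\pi^2}{3\omega_1^2}(a^4+b^4)z & y\\ z & 0 & -2x+\frac{\pi^2}{3\omega_1^2}(a^4+b^4)z\end{pmatrix}.$$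
   Context: The Jacobi theta functions are, for $z\in\mathbb{C}$ and $\tau$ in the upper half plane, $\theta_3(z,\tau)=\sum_{n\in\mathbb{Z}}\exp(\pi i n^2\tau+2\pi i n z)$, $\theta_2(z,\tau)=\exp(\pi i\tau/4+\pi i z)\,\theta_3(z+\tau/2,\tau)$, $\theta_4(z,\tau)=\theta_3(z+1/2,\tau)$. The values $a,b,c$ are the even theta constants. *)

theory Defs
  imports
    "HOL-Analysis.Analysis"
    "HOL-Library.Poly_Mapping"
    "HOL-Library.Numeral_Type"
    "HOL-Algebra.Algebraic_Closure_Type"
begin

section \<open>Polynomials in three variables\<close>

text \<open>
  A polynomial maps each exponent vector, itself of type \<^typ>\<open>3 \<Rightarrow>\<^sub>0 nat\<close>, to its coefficient;
  the ring operations are those of \<^theory>\<open>HOL-Library.Poly_Mapping\<close>. The variables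
  \<open>x, y, z\<close> are numbered \<open>1, 2, 3\<close>, as are the components of vectors in \<^typ>\<open>'a ^ 3\<close>.
\<close>

type_synonym 'a poly3 = "(3 \<Rightarrow>\<^sub>0 nat) \<Rightarrow>\<^sub>0 'a"

definition Const :: "'a::zero \<Rightarrow> 'a poly3" where
  "Const c = Poly_Mapping.single 0 c"

definition Var :: "3 \<Rightarrow> 'a::zero_neq_one poly3" where
  "Var i = Poly_Mapping.single (Poly_Mapping.single i 1) 1"

abbreviation \<x> :: "'a::zero_neq_one poly3" where "\<x> \<equiv> Var 1"
abbreviation \<y> :: "'a::zero_neq_one poly3" where "\<y> \<equiv> Var 2"
abbreviation \<z> :: "'a::zero_neq_one poly3" where "\<z> \<equiv> Var 3"

definition eval3 :: "'a::comm_semiring_1 poly3 \<Rightarrow> 'a ^ 3 \<Rightarrow> 'a" where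
  "eval3 F v =
     (\<Sum>m\<in>Poly_Mapping.keys F. Poly_Mapping.lookup F m * (\<Prod>i\<in>UNIV. v $ i ^ Poly_Mapping.lookup m i))"

text \<open>
  The truncated subtraction of exponents is harmless: if the variable \<open>i\<close> does not occur in
  the monomial \<open>m\<close>, the coefficient of the corresponding summand is 0.
\<close>

definition pderiv3 :: "3 \<Rightarrow> 'a::comm_semiring_1 poly3 \<Rightarrow> 'a poly3" where
  "pderiv3 i F =
     (\<Sum>m\<in>Poly_Mapping.keys F.
        Poly_Mapping.single (m - Poly_Mapping.single i 1)
          (of_nat (Poly_Mapping.lookup m i) * Poly_Mapping.lookup F m))"

definition extend_to_closure :: "'a::field poly3 \<Rightarrow> 'a alg_closure poly3" where
  "extend_to_closure F = Poly_Mapping.map to_ac F"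


section \<open>Smooth plane curves and Weierstrass cubics\<close>

text \<open>
  Smoothness of the projective plane curve given by a homogeneous polynomial of positive degree
  over a field \<open>K\<close>: no point of the projective plane over the algebraic closure of \<open>K\<close> is a
  common zero of the polynomial and its partial derivatives. Points of the projective plane are
  represented by nonzero vectors of homogeneous coordinates.
\<close>

definition defines_smooth_plane_curve :: "'a::field poly3 \<Rightarrow> bool" where
  "defines_smooth_plane_curve F \<longleftrightarrow>
     (\<forall>v :: 'a alg_closure ^ 3. v \<noteq> 0 \<longrightarrow> eval3 (extend_to_closure F) v = 0 \<longrightarrow>
        (\<exists>i. eval3 (pderiv3 i (extend_to_closure F)) v \<noteq> 0))"

definition weierstrass_cubic :: "'a::field \<Rightarrow> 'a \<Rightarrow> 'a poly3" where
  "weierstrass_cubic g2 g3 = \<y> ^ 2 * \<z> - 4 * \<x> ^ 3 + Const g2 * \<x> * \<z> ^ 2 + Const g3 * \<z> ^ 3"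


section \<open>Lattices and theta functions\<close>

definition period_lattice :: "complex \<Rightarrow> complex \<Rightarrow> complex set" where
  "period_lattice \<omega>1 \<omega>2 = {of_int m * \<omega>1 + of_int n * \<omega>2 | m n. True}"

text \<open>The sums below are unordered; they converge absolutely for a lattice of rank 2, respectively
  for \<open>\<tau>\<close> in the upper half plane, the only cases that matter.\<close>

definition lattice_g2 :: "complex set \<Rightarrow> complex" where
  "lattice_g2 \<Lambda> = 60 * (\<Sum>\<^sub>\<infinity>\<omega>\<in>\<Lambda> - {0}. 1 / \<omega> ^ 4)"

definition lattice_g3 :: "complex set \<Rightarrow> complex" where
  "lattice_g3 \<Lambda> = 140 * (\<Sum>\<^sub>\<infinity>\<omega>\<in>\<Lambda> - {0}. 1 / \<omega> ^ 6)"

definition theta3 :: "complex \<Rightarrow> complex \<Rightarrow> complex" where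
  "theta3 z \<tau> =
     (\<Sum>\<^sub>\<infinity>n\<in>(UNIV :: int set).
        exp (of_real pi * \<i> * of_int n ^ 2 * \<tau> + 2 * of_real pi * \<i> * of_int n * z))"

definition theta2 :: "complex \<Rightarrow> complex \<Rightarrow> complex" where
  "theta2 z \<tau> = exp (of_real pi * \<i> * \<tau> / 4 + of_real pi * \<i> * z) * theta3 (z + \<tau> / 2) \<tau>"

definition theta4 :: "complex \<Rightarrow> complex \<Rightarrow> complex" where
  "theta4 z \<tau> = theta3 (z + 1 / 2) \<tau>"

end

theory Submission
  imports Defs "HOL-Complex_Analysis.Complex_Analysis"
begin

text \<open>
  The first identity is a polynomial computation. By it, the second one amounts to saying that
  \<open>-e\<close> is a root of \<open>4 x^3 - g2 x - g3\<close> and that the difference of the other two roots is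
  \<open>(\<pi>/\<omega>1)^2 c^4\<close> up to sign. After scaling to the lattice spanned by 1 and \<open>\<tau>\<close>, the roots are the values of the
  Weierstrass function at the half periods. The product of the Weierstrass function with the square of
  the odd theta function is an entire theta function of order two. Such functions form a
  two-dimensional space, spanned by \<open>theta3 (2 z) (2 \<tau>)\<close> and \<open>theta2 (2 z) (2 \<tau>)\<close>; evaluating at the
  half periods expresses the differences of the roots by theta constants and the derivative at 0 of
  the odd theta function. That derivative is given by Jacobi's formula.
\<close>

section \<open>Weierstrass cubics as determinants\<close>

text \<open>For a root t = e3 and d = 0, the corner entry 3 t^2 - g2 of the determinant equals -(e1
  - e2)^2, because the three roots sum to zero. So the value of e3 and one squared difference settle
  the second identity, and e3 follows from e1 - e3, e2 - e3 and the zero sum. Differences are also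
  what the theta functions give without solving for anything. Let \<alpha>, \<beta> be the
  coordinates of the entire product in the two-dimensional space, and a, b the constants
  \<open>theta3 0 (2 * \<tau>)\<close>, \<open>theta2 0 (2 * \<tau>)\<close>. At each half period
  the product is a linear form in \<alpha>, \<beta>, and the duplication formulas make every
  difference of roots a multiple of the single form \<alpha> a + \<beta> b. This form is the value
  of the product at 0, hence the square of the derivative of the odd theta function, so \<alpha> and
  \<beta> are never computed.\<close>

lemma Const_add: "Const (a + b :: 'a::comm_ring_1) = Const a + Const b"
  and Const_mult: "Const (a * b) = Const a * Const b"
  and Const_minus: "Const (- a) = - Const a"
  and Const_diff: "Const (a - b) = Const a - Const b"
  and Const_numeral: "Const (numeral k) = numeral k"
  by (simp_all add: Const_def single_add mult_single single_uminus single_diff)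

lemma Const_power: "Const (a ^ n :: 'a::comm_ring_1) = Const a ^ n"
  by (induction n) (simp_all add: Const_mult, simp add: Const_def)

lemmas Const_hom = Const_add Const_mult Const_minus Const_diff Const_numeral Const_power

text \<open>Base change acts on coefficients, which a product of variables hides. Once the cubic is
  a sum of monomials, additivity of base change suffices.\<close>

lemma weierstrass_cubic_single:
  "weierstrass_cubic g2 g3 =
     Poly_Mapping.single (Poly_Mapping.single 2 2 + Poly_Mapping.single 3 1) 1
   - Poly_Mapping.single (Poly_Mapping.single 1 3) 4
   + Poly_Mapping.single (Poly_Mapping.single 1 1 + Poly_Mapping.single 3 2) g2
   + Poly_Mapping.single (Poly_Mapping.single 3 3) g3"
proof -
  have 4: "(4 :: 'a poly3) = Poly_Mapping.single 0 4"
    by simp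
  have pow: "Poly_Mapping.single i 1 + (Poly_Mapping.single i 1 + Poly_Mapping.single i 1) = Poly_Mapping.single i (3::nat)"
            "Poly_Mapping.single i 1 + Poly_Mapping.single i 1 = Poly_Mapping.single i (2::nat)"
            "Poly_Mapping.single i 2 + Poly_Mapping.single i 1 = Poly_Mapping.single i (3::nat)" for i :: 3
    by (simp_all add: numeral_eq_Suc flip: single_add)
  show ?thesis
    unfolding weierstrass_cubic_def 4
    by (simp add: Const_def Var_def power2_eq_square power3_eq_cube mult_single pow add.assoc
             del: single_numeral One_nat_def)
qed

lemma lookup_extend_to_closure:
  "Poly_Mapping.lookup (extend_to_closure F) m = to_ac (Poly_Mapping.lookup F m)"
  by (simp add: extend_to_closure_def map.rep_eq when_def)

lemma extend_to_closure_add: "extend_to_closure (F + G) = extend_to_closure F + extend_to_closure G"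
  and extend_to_closure_diff: "extend_to_closure (F - G) = extend_to_closure F - extend_to_closure G"
  by (simp_all add: poly_mapping_eq_iff fun_eq_iff lookup_extend_to_closure lookup_add lookup_minus)

lemma extend_to_closure_weierstrass:
  "extend_to_closure (weierstrass_cubic g2 g3) = weierstrass_cubic (to_ac g2) (to_ac g3)"
  by (simp add: weierstrass_cubic_single extend_to_closure_add extend_to_closure_diff)
     (simp add: extend_to_closure_def)

text \<open>The hypothesis says that (t, d) is an affine point of the curve. Solving it for
  \<open>g3\<close>, which enters linearly, leaves an identity of polynomials with integer
  coefficients, so it holds in every characteristic.\<close>

lemma weierstrass_cubic_det:
  fixes g2 g3 t d :: "'a::field"
  assumes "d ^ 2 = 4 * t ^ 3 - g2 * t - g3"
  shows "weierstrass_cubic g2 g3 = det (vector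
     [vector [2 * \<x> + Const t * \<z>, \<y> + Const d * \<z>, Const (3 * t ^ 2 - g2) * \<z>],
      vector [0, \<x> - Const t * \<z>, \<y> - Const d * \<z>],
      vector [\<z>, 0, - 2 * \<x> - Const t * \<z>]] :: 'a poly3 ^ 3 ^ 3)"
proof -
  have "g3 = 4 * t ^ 3 - g2 * t - d ^ 2"
    using assms by (simp add: algebra_simps)
  then have g3: "Const g3 = 4 * Const t ^ 3 - Const g2 * Const t - Const d ^ 2"
    by (simp add: Const_hom)
  show ?thesis
    by (simp add: det_3 vector_3 weierstrass_cubic_def g3 Const_hom
          power2_eq_square power3_eq_cube algebra_simps)
qed

section \<open>Infinite sums\<close>

text \<open>Weierstrass's convergence theorem for unordered sums. A majorant of the terms themselves
  suffices: the finite partial sums converge uniformly on a closed disc, and uniform limits of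
  holomorphic functions may be differentiated. Summability of the derivatives is part of the
  result.\<close>

lemma has_field_derivative_infsum:
  fixes f :: "'a \<Rightarrow> complex \<Rightarrow> complex"
  assumes S: "open S" "z \<in> S"
    and f: "\<And>x z. x \<in> A \<Longrightarrow> z \<in> S \<Longrightarrow> (f x has_field_derivative f' x z) (at z)"
    and bound: "\<And>r. cball z r \<subseteq> S \<Longrightarrow> \<exists>M. M summable_on A \<and> (\<forall>x\<in>A. \<forall>y\<in>cball z r. norm (f x y) \<le> M x)"
  shows "(\<lambda>x. f' x z) summable_on A"
    and "((\<lambda>z. \<Sum>\<^sub>\<infinity>x\<in>A. f x z) has_field_derivative (\<Sum>\<^sub>\<infinity>x\<in>A. f' x z)) (at z)"
proof -
  obtain r where r: "r > 0" "cball z r \<subseteq> S"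
    using S open_contains_cball_eq by metis
  obtain M where M: "M summable_on A" "\<forall>x\<in>A. \<forall>y\<in>cball z r. norm (f x y) \<le> M x"
    using bound[OF r(2)] by (elim exE conjE) (rule that)
  have lim: "uniform_limit (cball z r) (\<lambda>Y y. \<Sum>x\<in>Y. f x y) (\<lambda>y. \<Sum>\<^sub>\<infinity>x\<in>A. f x y) (finite_subsets_at_top A)"
    by (rule Weierstrass_m_test_general[OF _ M(1)]) (use M(2) in blast)
  have cont: "\<forall>\<^sub>F Y in finite_subsets_at_top A. continuous_on (cball z r) (\<lambda>y. \<Sum>x\<in>Y. f x y) \<and>
       (\<forall>w\<in>ball z r. ((\<lambda>y. \<Sum>x\<in>Y. f x y) has_field_derivative (\<Sum>x\<in>Y. f' x w)) (at w))"
  proof (rule eventually_finite_subsets_at_top_weakI, intro conjI ballI)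
    fix Y assume Y: "finite Y" "Y \<subseteq> A"
    show "continuous_on (cball z r) (\<lambda>y. \<Sum>x\<in>Y. f x y)"
    proof (intro continuous_on_sum)
      fix x assume "x \<in> Y"
      then have "x \<in> A"
        using Y by blast
      have "(f x has_field_derivative f' x y) (at y within cball z r)" if "y \<in> cball z r" for y
        by (rule has_field_derivative_at_within[OF f[OF \<open>x \<in> A\<close> subsetD[OF r(2) that]]])
      then show "continuous_on (cball z r) (f x)"
        by (rule DERIV_continuous_on)
    qed
    show "((\<lambda>y. \<Sum>x\<in>Y. f x y) has_field_derivative (\<Sum>x\<in>Y. f' x w)) (at w)" if "w \<in> ball z r" for w
    proof (intro DERIV_sum f)
      show "x \<in> A" if "x \<in> Y" for x
        using that Y by blast
      show "w \<in> S"
        using that r(2) ball_subset_cball by blast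
    qed
  qed
  obtain g' where "continuous_on (cball z r) (\<lambda>y. \<Sum>\<^sub>\<infinity>x\<in>A. f x y)" and g': "\<And>w. w \<in> ball z r \<Longrightarrow>
      ((\<lambda>y. \<Sum>\<^sub>\<infinity>x\<in>A. f x y) has_field_derivative g' w) (at w) \<and>
      ((\<lambda>Y. \<Sum>x\<in>Y. f' x w) \<longlongrightarrow> g' w) (finite_subsets_at_top A)"
    by (rule has_complex_derivative_uniform_limit[OF cont lim finite_subsets_at_top_neq_bot r(1)])
      (rule that)
  have "z \<in> ball z r"
    using r by simp
  note g'z = g'[OF this]
  then have sum: "((\<lambda>x. f' x z) has_sum g' z) A"
    unfolding has_sum_def by blast
  then show "(\<lambda>x. f' x z) summable_on A"
    by (rule has_sum_imp_summable)
  show "((\<lambda>z. \<Sum>\<^sub>\<infinity>x\<in>A. f x z) has_field_derivative (\<Sum>\<^sub>\<infinity>x\<in>A. f' x z)) (at z)"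
    using g'z unfolding infsumI[OF sum] by blast
qed

text \<open>Dominated convergence as an interchange of two limits: the majorant makes the finite
  partial sums converge uniformly on the set \<open>K\<close> of parameters where the bound holds,
  and the filter eventually stays in \<open>K\<close>.\<close>

lemma tendsto_infsum_dominated:
  fixes f :: "'a \<Rightarrow> 'b \<Rightarrow> 'c::banach"
  assumes "\<forall>\<^sub>F k in F. \<forall>x\<in>A. norm (f x k) \<le> M x" "M summable_on A"
    and f: "\<And>x. x \<in> A \<Longrightarrow> (f x \<longlongrightarrow> g x) F" and g: "(g has_sum s) A"
  shows "((\<lambda>k. \<Sum>\<^sub>\<infinity>x\<in>A. f x k) \<longlongrightarrow> s) F"
proof -
  define K where "K = Collect (\<lambda>k. \<forall>x\<in>A. norm (f x k) \<le> M x)"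
  show ?thesis
  proof (rule swap_uniform_limit'[where S = K and F = "finite_subsets_at_top A" and g = "sum g"
          and f = "\<lambda>Y k. \<Sum>x\<in>Y. f x k"])
    show "uniform_limit K (\<lambda>Y y. \<Sum>x\<in>Y. f x y)
            (\<lambda>y. \<Sum>\<^sub>\<infinity>x\<in>A. f x y) (finite_subsets_at_top A)"
      by (rule Weierstrass_m_test_general[OF _ assms(2)]) (simp add: K_def)
    show "\<forall>\<^sub>F Y in finite_subsets_at_top A. ((\<lambda>k. \<Sum>x\<in>Y. f x k) \<longlongrightarrow> sum g Y) F"
      by (intro eventually_finite_subsets_at_top_weakI tendsto_sum f) blast
    show "(sum g \<longlongrightarrow> s) (finite_subsets_at_top A)"
      using g unfolding has_sum_def .
    show "\<forall>\<^sub>F k in F. k \<in> K"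
      using assms(1) unfolding K_def mem_Collect_eq .
  qed (rule finite_subsets_at_top_neq_bot)
qed

lemma infsum_product:
  fixes f :: "'a \<Rightarrow> 'c::{real_normed_field,banach}"
  assumes "(\<lambda>x. norm (f x)) summable_on A" "(\<lambda>x. norm (g x)) summable_on B"
  shows "(\<lambda>p. norm (case p of (x, y) \<Rightarrow> f x * g y)) summable_on A \<times> B"
    and "(\<Sum>\<^sub>\<infinity>x\<in>A. f x) * (\<Sum>\<^sub>\<infinity>y\<in>B. g y) = (\<Sum>\<^sub>\<infinity>(x, y)\<in>A \<times> B. f x * g y)"
proof -
  show *: "(\<lambda>p. norm (case p of (x, y) \<Rightarrow> f x * g y)) summable_on A \<times> B"
    unfolding Infinite_Sum.abs_summable_on_Sigma_iff
  proof (intro conjI ballI)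
    have "(\<lambda>x. norm (f x) * (\<Sum>\<^sub>\<infinity>y\<in>B. norm (g y))) summable_on A"
      by (intro summable_on_cmult_left assms)
    then show "(\<lambda>x. norm (\<Sum>\<^sub>\<infinity>y\<in>B. norm (case (x, y) of (x, y) \<Rightarrow> f x * g y))) summable_on A"
      by (simp add: norm_mult infsum_cmult_right' infsum_nonneg)
    show "(\<lambda>y. norm (case (x, y) of (x, y) \<Rightarrow> f x * g y)) summable_on B" for x
      by (auto simp: norm_mult intro!: summable_on_cmult_right assms)
  qed
  have "(\<Sum>\<^sub>\<infinity>(x, y)\<in>A \<times> B. f x * g y) = (\<Sum>\<^sub>\<infinity>x\<in>A. \<Sum>\<^sub>\<infinity>y\<in>B. f x * g y)"
    using abs_summable_summable[OF *] by (subst infsum_Sigma'_banach) auto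
  then show "(\<Sum>\<^sub>\<infinity>x\<in>A. f x) * (\<Sum>\<^sub>\<infinity>y\<in>B. g y) = (\<Sum>\<^sub>\<infinity>(x, y)\<in>A \<times> B. f x * g y)"
    by (simp add: infsum_cmult_right' infsum_cmult_left')
qed

lemma summable_on_int_abs:
  fixes g :: "nat \<Rightarrow> real"
  assumes "summable g" "\<And>n. g n \<ge> 0"
  shows "(\<lambda>n::int. g (nat \<bar>n\<bar>)) summable_on UNIV"
proof -
  have g: "g summable_on UNIV"
    using assms by (intro norm_summable_imp_summable_on) auto
  have U: "(UNIV :: int set) = int ` UNIV \<union> (\<lambda>n. - int n) ` {0<..}"
  proof (intro equalityI subsetI)
    fix n :: int
    show "n \<in> int ` UNIV \<union> (\<lambda>n. - int n) ` {0<..}"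
    proof (cases "n \<ge> 0")
      case True
      then show ?thesis
        by (intro UnI1 image_eqI[of n int "nat n"]) auto
    next
      case False
      then have "n = - int (nat (- n))" "nat (- n) \<in> {0<..}"
        by auto
      then show ?thesis
        by (intro UnI2 image_eqI[of n _ "nat (- n)"])
    qed
  qed simp
  have "(\<lambda>n::int. g (nat \<bar>n\<bar>)) summable_on int ` UNIV"
    using g by (subst summable_on_reindex) (auto simp: o_def inj_on_def)
  moreover have "(\<lambda>n::int. g (nat \<bar>n\<bar>)) summable_on (\<lambda>n. - int n) ` {0<..}"
    using summable_on_subset_banach[OF g, of "{0<..}"] by (subst summable_on_reindex) (auto simp: o_def inj_on_def)
  moreover have "int ` UNIV \<inter> (\<lambda>n. - int n) ` {0<..} = {}"
    by auto
  ultimately have "(\<lambda>n::int. g (nat \<bar>n\<bar>)) summable_on (int ` UNIV \<union> (\<lambda>n. - int n) ` {0<..})"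
    by (rule summable_on_Un_disjoint)
  then show ?thesis
    unfolding U[symmetric] .
qed

lemma summable_on_exp_neg_abs_int: "(\<lambda>n::int. exp (- \<bar>real_of_int n\<bar>)) summable_on UNIV"
proof -
  have "exp (- real n) = exp (- 1) ^ n" for n
    using exp_of_nat_mult[of n "- 1 :: real"] by simp
  then have "summable (\<lambda>n. exp (- real n))"
    by (simp add: summable_geometric)
  from summable_on_int_abs[OF this] show ?thesis
    by simp
qed

section \<open>Theta functions\<close>

definition theta_term :: "complex \<Rightarrow> complex \<Rightarrow> int \<Rightarrow> complex" where
  "theta_term z \<tau> n = exp (of_real pi * \<i> * of_int n ^ 2 * \<tau> + 2 * of_real pi * \<i> * of_int n * z)"

lemma theta3_altdef: "theta3 z \<tau> = (\<Sum>\<^sub>\<infinity>n. theta_term z \<tau> n)"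
  by (simp add: theta3_def theta_term_def)

lemma norm_theta_term:
  "norm (theta_term z \<tau> n) = exp (- pi * of_int n ^ 2 * Im \<tau> - 2 * pi * of_int n * Im z)"
  by (simp add: theta_term_def power2_eq_square)

text \<open>Completing the square gives c u - pi t u^2 \<le> c^2 / (4 pi t) for u = |n|. The summand
  1 in c = 2 pi R + 1 pays for the factor exp (-|n|), which makes the bound a summable majorant,
  uniform for z in a horizontal strip.\<close>

lemma norm_theta_term_le:
  assumes "t > 0" "Im \<tau> \<ge> t" "\<bar>Im z\<bar> \<le> R"
  shows "norm (theta_term z \<tau> n) \<le> exp ((2 * pi * R + 1)\<^sup>2 / (4 * pi * t)) * exp (- \<bar>real_of_int n\<bar>)"
proof -
  define u where "u = \<bar>real_of_int n\<bar>"
  define c where "c = 2 * pi * R + 1"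
  have u: "u \<ge> 0" "of_int n ^ 2 = u ^ 2"
    by (auto simp: u_def)
  have "- (of_int n * Im z) \<le> u * R"
    using abs_ge_minus_self[of "of_int n * Im z"] mult_left_mono[OF assms(3), of u]
    by (simp add: abs_mult u_def)
  from mult_left_mono[OF this, of "2 * pi"]
  have 1: "- 2 * pi * of_int n * Im z \<le> 2 * pi * R * u"
    by (simp add: algebra_simps)
  have 2: "pi * t * u\<^sup>2 \<le> pi * u\<^sup>2 * Im \<tau>"
    using mult_right_mono[OF assms(2), of "pi * u\<^sup>2"] by (simp add: mult_ac)
  have "0 \<le> pi * t * (u - c / (2 * (pi * t)))\<^sup>2"
    using assms by simp
  also have "\<dots> = pi * t * u\<^sup>2 - c * u + c\<^sup>2 / (4 * pi * t)"
    using assms by (simp add: power2_diff power_divide field_simps power2_eq_square)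
  finally have c: "- (pi * t * u\<^sup>2) + c * u \<le> c\<^sup>2 / (4 * pi * t)"
    by simp
  have "c * u = 2 * pi * R * u + u"
    by (simp add: c_def algebra_simps)
  then have "- pi * u\<^sup>2 * Im \<tau> - 2 * pi * of_int n * Im z \<le> c\<^sup>2 / (4 * pi * t) - u"
    using 1 2 c by linarith
  then have "exp (- pi * u\<^sup>2 * Im \<tau> - 2 * pi * of_int n * Im z) \<le> exp (c\<^sup>2 / (4 * pi * t) - u)"
    by simp
  then show ?thesis
    by (simp add: norm_theta_term c_def u_def exp_diff exp_minus field_simps)
qed

lemma theta_term_abs_summable:
  assumes "Im \<tau> > 0"
  shows "(\<lambda>n. norm (theta_term z \<tau> n)) summable_on UNIV"
proof (rule summable_on_comparison_test)
  show "(\<lambda>n. exp ((2 * pi * \<bar>Im z\<bar> + 1)\<^sup>2 / (4 * pi * Im \<tau>)) * exp (- \<bar>real_of_int n\<bar>)) summable_on UNIV"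
    by (intro summable_on_cmult_right summable_on_exp_neg_abs_int)
  show "norm (theta_term z \<tau> n) \<le>
      exp ((2 * pi * \<bar>Im z\<bar> + 1)\<^sup>2 / (4 * pi * Im \<tau>)) * exp (- \<bar>real_of_int n\<bar>)" for n
    by (rule norm_theta_term_le[OF assms]) auto
qed auto

lemma theta_term_summable: "Im \<tau> > 0 \<Longrightarrow> theta_term z \<tau> summable_on UNIV"
  by (rule abs_summable_summable) (rule theta_term_abs_summable)

lemma has_field_derivative_theta3:
  assumes "Im \<tau> > 0"
  shows "(\<lambda>n. 2 * of_real pi * \<i> * of_int n * theta_term z \<tau> n) summable_on UNIV" (is ?summable)
    and "((\<lambda>z. theta3 z \<tau>) has_field_derivative
           (\<Sum>\<^sub>\<infinity>n. 2 * of_real pi * \<i> * of_int n * theta_term z \<tau> n)) (at z)" (is ?deriv)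
proof -
  have deriv: "((\<lambda>z. theta_term z \<tau> n) has_field_derivative
          2 * of_real pi * \<i> * of_int n * theta_term z \<tau> n) (at z)" for n z
    unfolding theta_term_def by (auto intro!: derivative_eq_intros)
  have bound: "\<exists>M. M summable_on UNIV \<and> (\<forall>n\<in>UNIV. \<forall>y\<in>cball z r. norm (theta_term y \<tau> n) \<le> M n)" for r
  proof (intro exI conjI ballI)
    show "(\<lambda>n. exp ((2 * pi * (\<bar>Im z\<bar> + r) + 1)\<^sup>2 / (4 * pi * Im \<tau>)) * exp (- \<bar>real_of_int n\<bar>))
            summable_on UNIV"
      by (intro summable_on_cmult_right summable_on_exp_neg_abs_int)
    show "norm (theta_term y \<tau> n) \<le>
            exp ((2 * pi * (\<bar>Im z\<bar> + r) + 1)\<^sup>2 / (4 * pi * Im \<tau>)) * exp (- \<bar>real_of_int n\<bar>)"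
      if "y \<in> cball z r" for y n
    proof (rule norm_theta_term_le)
      have "\<bar>Im y - Im z\<bar> \<le> r"
        using that abs_Im_le_cmod[of "y - z"] by (simp add: dist_norm norm_minus_commute)
      then show "\<bar>Im y\<bar> \<le> \<bar>Im z\<bar> + r"
        by simp
    qed (use assms in auto)
  qed
  show ?summable ?deriv
    using has_field_derivative_infsum[of UNIV z UNIV "\<lambda>n z. theta_term z \<tau> n", OF _ _ deriv bound]
    by (simp_all add: theta3_altdef)
qed

lemma theta3_holomorphic [holomorphic_intros]:
  assumes "f holomorphic_on A" "Im \<tau> > 0"
  shows "(\<lambda>z. theta3 (f z) \<tau>) holomorphic_on A"
proof -
  have "(\<lambda>z. theta3 z \<tau>) holomorphic_on UNIV"
    using has_field_derivative_theta3(2)[OF assms(2)] by (auto simp: holomorphic_on_open)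
  from holomorphic_on_compose_gen[OF assms(1) this] show ?thesis
    by (simp add: o_def)
qed

section \<open>Quasi-periods and parity\<close>

lemma exp_2pi_i_int: "exp (2 * of_real pi * \<i> * of_int n) = 1"
  using exp_integer_2pi[of "of_int n"] by (simp add: mult_ac)

lemma exp_pi_i_add: "exp (z + of_real pi * \<i>) = - exp z"
  by (simp add: exp_add)

lemma theta3_minus: "theta3 (- z) \<tau> = theta3 z \<tau>"
  unfolding theta3_altdef
  by (rule infsum_reindex_bij_witness[of _ uminus uminus]) (simp_all add: theta_term_def)

lemma theta3_plus_1: "theta3 (z + 1) \<tau> = theta3 z \<tau>"
proof -
  have "theta_term (z + 1) \<tau> n = theta_term z \<tau> n" for n
    unfolding theta_term_def using exp_2pi_i_int[of n]
    by (simp add: distrib_left exp_add)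
  then show ?thesis
    by (simp add: theta3_altdef)
qed

text \<open>Replacing n by n + 1 in n^2 \<tau> produces the linear term 2 n \<tau> that the
  translation adds to the exponent.\<close>

lemma theta3_plus_tau: "theta3 (z + \<tau>) \<tau> = exp (- of_real pi * \<i> * \<tau> - 2 * of_real pi * \<i> * z) * theta3 z \<tau>"
proof -
  have "exp (- of_real pi * \<i> * \<tau> - 2 * of_real pi * \<i> * z) * theta_term z \<tau> (n + 1) = theta_term (z + \<tau>) \<tau> n" for n
    unfolding theta_term_def
    by (simp add: power2_eq_square algebra_simps flip: exp_add)
  then have "theta3 (z + \<tau>) \<tau> =
      (\<Sum>\<^sub>\<infinity>n. exp (- of_real pi * \<i> * \<tau> - 2 * of_real pi * \<i> * z) * theta_term z \<tau> n)"
    unfolding theta3_altdef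
    by (intro infsum_reindex_bij_witness[of _ "\<lambda>n. n - 1" "\<lambda>n. n + 1"]) auto
  then show ?thesis
    by (simp add: theta3_altdef infsum_cmult_right')
qed

lemma theta2_plus_1: "theta2 (z + 1) \<tau> = - theta2 z \<tau>"
proof -
  have "theta3 (z + 1 + \<tau> / 2) \<tau> = theta3 (z + \<tau> / 2) \<tau>"
    using theta3_plus_1[of "z + \<tau> / 2" \<tau>] by (simp add: add_ac)
  then show ?thesis
    unfolding theta2_def by (simp add: distrib_left exp_add)
qed

text \<open>Together with its counterpart for \<open>theta2\<close>: translation by half a
  quasi-period interchanges \<open>theta2\<close> and \<open>theta3\<close> up to an exponential
  factor. This turns values at half periods into theta constants.\<close>

lemma theta3_plus_half_tau:
  "theta3 (z + \<tau> / 2) \<tau> = exp (- of_real pi * \<i> * \<tau> / 4 - of_real pi * \<i> * z) * theta2 z \<tau>"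
  unfolding theta2_def by (simp add: mult.assoc[symmetric] flip: exp_add)

lemma theta2_plus_half_tau:
  "theta2 (z + \<tau> / 2) \<tau> = exp (- of_real pi * \<i> * \<tau> / 4 - of_real pi * \<i> * z) * theta3 z \<tau>"
proof -
  have 1: "z + \<tau> / 2 + \<tau> / 2 = z + \<tau>"
    by simp
  have "of_real pi * \<i> * \<tau> / 4 + of_real pi * \<i> * (z + \<tau> / 2) + (- of_real pi * \<i> * \<tau> - 2 * of_real pi * \<i> * z) =
      - of_real pi * \<i> * \<tau> / 4 - of_real pi * \<i> * z"
    by (rule mult_left_cancel[THEN iffD1, of 4]) (simp_all add: algebra_simps)
  then show ?thesis
    unfolding theta2_def 1 theta3_plus_tau mult.assoc[symmetric] exp_add[symmetric] by (simp only:)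
qed

lemma theta2_minus: "theta2 (- z) \<tau> = theta2 z \<tau>"
proof -
  have 1: "theta3 (- z + \<tau> / 2) \<tau> = theta3 (z - \<tau> / 2) \<tau>"
    using theta3_minus[of "z - \<tau> / 2" \<tau>] by simp
  have "z - \<tau> / 2 + \<tau> = z + \<tau> / 2"
    by simp
  then have 2: "theta3 (z + \<tau> / 2) \<tau> =
      exp (- of_real pi * \<i> * \<tau> - 2 * of_real pi * \<i> * (z - \<tau> / 2)) * theta3 (z - \<tau> / 2) \<tau>"
    using theta3_plus_tau[of "z - \<tau> / 2" \<tau>] by (simp only:)
  have "of_real pi * \<i> * \<tau> / 4 + of_real pi * \<i> * - z =
      of_real pi * \<i> * \<tau> / 4 + of_real pi * \<i> * z + (- of_real pi * \<i> * \<tau> - 2 * of_real pi * \<i> * (z - \<tau> / 2))"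
    by (simp add: algebra_simps)
  then show ?thesis
    unfolding theta2_def 1 2 mult.assoc[symmetric] exp_add[symmetric] by (simp only:)
qed

lemma theta2_half: "theta2 (1 / 2) \<tau> = 0"
  using theta2_plus_1[of "- (1 / 2)" \<tau>] theta2_minus[of "1 / 2" \<tau>] by simp

section \<open>Product and duplication formulas\<close>

lemma theta_term_product:
  "theta_term x \<tau> (u + v) * theta_term y \<tau> (u - v) = theta_term (x + y) (2 * \<tau>) u * theta_term (x - y) (2 * \<tau>) v"
  unfolding theta_term_def exp_add[symmetric] by (simp add: power2_eq_square algebra_simps)

text \<open>The law (u + v)^2 + (u - v)^2 = 2 u^2 + 2 v^2 separates the variables and doubles
  \<tau>. Here it is used for u + 1/2 and v + 1/2, with sum u + v + 1 and difference u - v; the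
  halves become the translation by half of 2\<tau> and the prefactors in the definition of
  \<open>theta2\<close>.\<close>

lemma theta_term_product':
  "theta_term x \<tau> (u + v + 1) * theta_term y \<tau> (u - v) =
     exp (of_real pi * \<i> * (2 * \<tau>) / 4 + of_real pi * \<i> * (x + y)) *
     exp (of_real pi * \<i> * (2 * \<tau>) / 4 + of_real pi * \<i> * (x - y)) *
     (theta_term (x + y + 2 * \<tau> / 2) (2 * \<tau>) u * theta_term (x - y + 2 * \<tau> / 2) (2 * \<tau>) v)"
  unfolding theta_term_def exp_add[symmetric]
  by (rule arg_cong[of _ _ exp], rule mult_left_cancel[THEN iffD1, of 2])
     (simp_all add: power2_eq_square algebra_simps)

text \<open>Multiplying the series gives a sum over pairs (m, n). The pairs with m + n even are (u +
  v, u - v), the others (u + v + 1, u - v); these two classes yield the two products on the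
  right.\<close>

lemma theta3_product:
  assumes "Im \<tau> > 0"
  shows "theta3 x \<tau> * theta3 y \<tau> =
           theta3 (x + y) (2 * \<tau>) * theta3 (x - y) (2 * \<tau>) + theta2 (x + y) (2 * \<tau>) * theta2 (x - y) (2 * \<tau>)"
proof -
  have \<tau>2: "Im (2 * \<tau>) > 0"
    using assms by simp
  note prod = infsum_product[OF theta_term_abs_summable theta_term_abs_summable]
  define f where "f = (\<lambda>(m, n). theta_term x \<tau> m * theta_term y \<tau> n)"
  define Ev where "Ev = {(m::int, n::int). even (m + n)}"
  have f: "f summable_on UNIV"
    using abs_summable_summable[OF prod(1)[OF assms assms]] by (simp add: f_def)
  have "theta3 x \<tau> * theta3 y \<tau> = infsum f UNIV"
    using prod(2)[OF assms assms] by (simp add: f_def theta3_altdef)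
  also have "\<dots> = infsum f (Ev \<union> - Ev)"
    by simp
  also have "\<dots> = infsum f Ev + infsum f (- Ev)"
    by (rule infsum_Un_disjoint) (auto intro: summable_on_subset_banach[OF f])
  also have "infsum f Ev = (\<Sum>\<^sub>\<infinity>(u, v)\<in>UNIV \<times> UNIV. theta_term (x + y) (2 * \<tau>) u * theta_term (x - y) (2 * \<tau>) v)"
  proof (rule infsum_reindex_bij_witness[symmetric, of _ "\<lambda>(m, n). ((m + n) div 2, (m - n) div 2)" "\<lambda>(u, v). (u + v, u - v)"])
    fix p :: "int \<times> int"
    assume "p \<in> Ev"
    then have "even (fst p + snd p)"
      by (simp add: Ev_def case_prod_unfold)
    then obtain k where "fst p + snd p = 2 * k"
      by (rule evenE)
    then have "p = (fst p, 2 * k - fst p)"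
      by (simp add: prod_eq_iff)
    then show "(\<lambda>(u, v). (u + v, u - v)) ((\<lambda>(m, n). ((m + n) div 2, (m - n) div 2)) p) = p"
      by (cases p) auto
  qed (auto simp: Ev_def f_def theta_term_product)
  also have "\<dots> = theta3 (x + y) (2 * \<tau>) * theta3 (x - y) (2 * \<tau>)"
    unfolding theta3_altdef by (rule prod(2)[OF \<tau>2 \<tau>2, symmetric])
  also have "infsum f (- Ev) = (\<Sum>\<^sub>\<infinity>p\<in>UNIV \<times> UNIV.
     exp (of_real pi * \<i> * (2 * \<tau>) / 4 + of_real pi * \<i> * (x + y)) *
     exp (of_real pi * \<i> * (2 * \<tau>) / 4 + of_real pi * \<i> * (x - y)) *
     (case p of (u, v) \<Rightarrow> theta_term (x + y + 2 * \<tau> / 2) (2 * \<tau>) u * theta_term (x - y + 2 * \<tau> / 2) (2 * \<tau>) v))"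
  proof (rule infsum_reindex_bij_witness[symmetric, of _ "\<lambda>(m, n). ((m + n - 1) div 2, (m - n - 1) div 2)" "\<lambda>(u, v). (u + v + 1, u - v)"])
    fix p :: "int \<times> int"
    assume "p \<in> (- Ev)"
    then have "odd (fst p + snd p)"
      by (simp add: Ev_def case_prod_unfold)
    then obtain k where "fst p + snd p = 2 * k + 1"
      by (rule oddE)
    then have "p = (fst p, 2 * k + 1 - fst p)"
      by (simp add: prod_eq_iff)
    then show "(\<lambda>(u, v). (u + v + 1, u - v)) ((\<lambda>(m, n). ((m + n - 1) div 2, (m - n - 1) div 2)) p) = p"
      by (cases p) auto
  qed (simp_all add: Ev_def f_def case_prod_unfold theta_term_product')
  also have "\<dots> = theta2 (x + y) (2 * \<tau>) * theta2 (x - y) (2 * \<tau>)"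
    unfolding infsum_cmult_right' prod(2)[OF \<tau>2 \<tau>2, symmetric] theta2_def theta3_altdef by (simp only: mult_ac)
  finally show ?thesis .
qed

text \<open>This is \<open>\<i>\<close> times the classical first theta function.\<close>

definition theta1 :: "complex \<Rightarrow> complex \<Rightarrow> complex" where
  "theta1 z \<tau> = exp (of_real pi * \<i> * \<tau> / 4 + of_real pi * \<i> * z) * theta3 (z + \<tau> / 2 + 1 / 2) \<tau>"

lemma theta1_altdef: "theta1 z \<tau> = - \<i> * theta2 (z + 1 / 2) \<tau>"
proof -
  have "of_real pi * \<i> * \<tau> / 4 + of_real pi * \<i> * (z + 1 / 2) = (of_real pi * \<i> * \<tau> / 4 + of_real pi * \<i> * z) + of_real pi / 2 * \<i>"
    by (simp add: algebra_simps)
  moreover have "exp (of_real pi / 2 * \<i>) = \<i>"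
    using cis_pi_half by (simp add: cis_conv_exp mult.commute)
  ultimately have "exp (of_real pi * \<i> * \<tau> / 4 + of_real pi * \<i> * (z + 1 / 2)) =
      exp (of_real pi * \<i> * \<tau> / 4 + of_real pi * \<i> * z) * \<i>"
    by (metis exp_add)
  moreover have "z + 1 / 2 + \<tau> / 2 = z + \<tau> / 2 + 1 / 2"
    by simp
  ultimately show ?thesis
    unfolding theta1_def theta2_def by (simp add: add_ac) (simp add: mult_ac)
qed

lemma theta2_plus_tau:
  "theta2 (z + \<tau>) \<tau> = exp (- of_real pi * \<i> * \<tau> - 2 * of_real pi * \<i> * z) * theta2 z \<tau>"
proof -
  have "z + \<tau> = z + \<tau> / 2 + \<tau> / 2"
    by simp
  then have "theta2 (z + \<tau>) \<tau> = theta2 (z + \<tau> / 2 + \<tau> / 2) \<tau>"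
    by (rule arg_cong)
  also have "\<dots> = exp ((- of_real pi * \<i> * \<tau> / 4 - of_real pi * \<i> * (z + \<tau> / 2)) +
       (- of_real pi * \<i> * \<tau> / 4 - of_real pi * \<i> * z)) * theta2 z \<tau>"
    by (simp only: theta2_plus_half_tau theta3_plus_half_tau exp_add mult.assoc)
  also have "(- of_real pi * \<i> * \<tau> / 4 - of_real pi * \<i> * (z + \<tau> / 2)) +
       (- of_real pi * \<i> * \<tau> / 4 - of_real pi * \<i> * z) = - of_real pi * \<i> * \<tau> - 2 * of_real pi * \<i> * z"
    by (simp add: algebra_simps)
  finally show ?thesis .
qed

lemma theta1_plus_1: "theta1 (z + 1) \<tau> = - theta1 z \<tau>"
  using theta2_plus_1[of "z + 1 / 2" \<tau>] by (simp add: theta1_altdef add_ac)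

lemma theta1_plus_tau:
  "theta1 (z + \<tau>) \<tau> = - exp (- of_real pi * \<i> * \<tau> - 2 * of_real pi * \<i> * z) * theta1 z \<tau>"
proof -
  have "z + \<tau> + 1 / 2 = z + 1 / 2 + \<tau>"
    by simp
  moreover have "- of_real pi * \<i> * \<tau> - 2 * of_real pi * \<i> * z =
      - of_real pi * \<i> * \<tau> - 2 * of_real pi * \<i> * (z + 1 / 2) + of_real pi * \<i>"
    by (simp add: algebra_simps)
  ultimately show ?thesis
    by (simp only: theta1_altdef theta2_plus_tau exp_pi_i_add) simp
qed

lemma theta1_0: "theta1 0 \<tau> = 0"
  by (simp add: theta1_altdef theta2_half)

text \<open>Both arguments are moved by \<tau>/2. Their sum then moves by half a quasi-period of
  2\<tau>, which interchanges \<open>theta2\<close> and \<open>theta3\<close> in the first factors,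
  while their difference stays fixed.\<close>

lemma theta2_product:
  assumes "Im \<tau> > 0"
  shows "theta2 x \<tau> * theta2 y \<tau> =
           theta2 (x + y) (2 * \<tau>) * theta3 (x - y) (2 * \<tau>) + theta3 (x + y) (2 * \<tau>) * theta2 (x - y) (2 * \<tau>)"
proof -
  define E where "E = exp (of_real pi * \<i> * (2 * \<tau>) / 4 + of_real pi * \<i> * (x + y))"
  have E: "exp (- of_real pi * \<i> * (2 * \<tau>) / 4 - of_real pi * \<i> * (x + y)) = inverse E"
    unfolding E_def exp_minus[symmetric] by simp
  have "exp (of_real pi * \<i> * \<tau> / 4 + of_real pi * \<i> * x) * exp (of_real pi * \<i> * \<tau> / 4 + of_real pi * \<i> * y) = E"
    (is "?e * ?e' = E")
    unfolding E_def exp_add[symmetric] by (simp add: algebra_simps)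
  moreover have "theta2 x \<tau> * theta2 y \<tau> = (?e * ?e') * (theta3 (x + \<tau> / 2) \<tau> * theta3 (y + \<tau> / 2) \<tau>)"
    unfolding theta2_def by (simp only: mult_ac)
  ultimately have "theta2 x \<tau> * theta2 y \<tau> = E * (theta3 (x + \<tau> / 2) \<tau> * theta3 (y + \<tau> / 2) \<tau>)"
    by (simp only:)
  also have "\<dots> = E * (theta3 (x + y + 2 * \<tau> / 2) (2 * \<tau>) * theta3 (x - y) (2 * \<tau>) +
      theta2 (x + y + 2 * \<tau> / 2) (2 * \<tau>) * theta2 (x - y) (2 * \<tau>))"
    by (simp add: theta3_product[OF assms] add_ac)
  also have "\<dots> = theta2 (x + y) (2 * \<tau>) * theta3 (x - y) (2 * \<tau>) + theta3 (x + y) (2 * \<tau>) * theta2 (x - y) (2 * \<tau>)"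
    unfolding theta3_plus_half_tau theta2_plus_half_tau E by (simp add: E_def algebra_simps)
  finally show ?thesis .
qed

text \<open>The case x = y = z + 1/2 of \<open>theta2_product\<close>. It yields the coordinates of
  the squared odd theta function in the basis of the space of order two.\<close>

lemma theta1_square:
  assumes "Im \<tau> > 0"
  shows "theta1 z \<tau> ^ 2 = theta3 0 (2 * \<tau>) * theta2 (2 * z) (2 * \<tau>) - theta2 0 (2 * \<tau>) * theta3 (2 * z) (2 * \<tau>)"
  using theta2_product[OF assms, of "z + 1 / 2" "z + 1 / 2"] theta2_plus_1[of "2 * z" "2 * \<tau>"] theta3_plus_1[of "2 * z" "2 * \<tau>"]
  by (simp add: theta1_altdef power2_eq_square algebra_simps)

lemma theta2_0_square: "Im \<tau> > 0 \<Longrightarrow> theta2 0 \<tau> ^ 2 = 2 * theta2 0 (2 * \<tau>) * theta3 0 (2 * \<tau>)"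
  using theta2_product[of \<tau> 0 0] by (simp add: power2_eq_square)

lemma theta3_0_square: "Im \<tau> > 0 \<Longrightarrow> theta3 0 \<tau> ^ 2 = theta3 0 (2 * \<tau>) ^ 2 + theta2 0 (2 * \<tau>) ^ 2"
  using theta3_product[of \<tau> 0 0] by (simp add: power2_eq_square)

lemma theta4_0_square: "Im \<tau> > 0 \<Longrightarrow> theta4 0 \<tau> ^ 2 = theta3 0 (2 * \<tau>) ^ 2 - theta2 0 (2 * \<tau>) ^ 2"
  using theta3_product[of \<tau> "1 / 2" "1 / 2"] theta2_plus_1[of 0 "2 * \<tau>"] theta3_plus_1[of 0 "2 * \<tau>"]
  by (simp add: power2_eq_square theta4_def)

lemma theta3_theta4_0: "Im \<tau> > 0 \<Longrightarrow> theta3 0 \<tau> * theta4 0 \<tau> = theta4 0 (2 * \<tau>) ^ 2"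
  using theta3_product[of \<tau> 0 "1 / 2"] theta3_minus[of "1 / 2" "2 * \<tau>"]
  by (simp add: power2_eq_square theta4_def theta2_half)

text \<open>Arguments that differ by 1/2 make one of the two products vanish, by
  \<open>theta2_half\<close>. Differentiating the result at 0 gives the behaviour of the derivative
  of \<open>theta1\<close> under doubling of \<tau>.\<close>

lemma theta1_theta2:
  "Im \<tau> > 0 \<Longrightarrow> theta1 z \<tau> * theta2 z \<tau> = theta1 (2 * z) (2 * \<tau>) * theta4 0 (2 * \<tau>)"
  using theta2_product[of \<tau> "z + 1 / 2" z]
  by (simp add: theta1_altdef theta4_def theta2_half add_ac)

section \<open>Jacobi's derivative formula\<close>

lemma theta2_holomorphic [holomorphic_intros]:
  "f holomorphic_on A \<Longrightarrow> Im \<tau> > 0 \<Longrightarrow> (\<lambda>z. theta2 (f z) \<tau>) holomorphic_on A"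
  unfolding theta2_def by (intro holomorphic_intros)

lemma theta1_holomorphic [holomorphic_intros]:
  "f holomorphic_on A \<Longrightarrow> Im \<tau> > 0 \<Longrightarrow> (\<lambda>z. theta1 (f z) \<tau>) holomorphic_on A"
  unfolding theta1_def by (intro holomorphic_intros)

lemma has_field_derivative_theta1:
  "Im \<tau> > 0 \<Longrightarrow> ((\<lambda>z. theta1 z \<tau>) has_field_derivative deriv (\<lambda>z. theta1 z \<tau>) z) (at z)"
  by (rule holomorphic_derivI[of _ UNIV]) (auto intro: holomorphic_intros)

lemma deriv_theta1_double:
  assumes "Im \<tau> > 0"
  shows "deriv (\<lambda>z. theta1 z \<tau>) 0 * theta2 0 \<tau> = 2 * deriv (\<lambda>z. theta1 z (2 * \<tau>)) 0 * theta4 0 (2 * \<tau>)"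
proof -
  have \<tau>2: "Im (2 * \<tau>) > 0"
    using assms by simp
  have 2: "((\<lambda>z. theta2 z \<tau>) has_field_derivative deriv (\<lambda>z. theta2 z \<tau>) 0) (at 0)"
    by (rule holomorphic_derivI[of _ UNIV]) (use assms in \<open>auto intro: holomorphic_intros\<close>)
  have "((\<lambda>z. theta1 z \<tau> * theta2 z \<tau>) has_field_derivative deriv (\<lambda>z. theta1 z \<tau>) 0 * theta2 0 \<tau>) (at 0)"
    by (rule DERIV_cong[OF DERIV_mult[OF has_field_derivative_theta1[OF assms] 2]]) (simp add: theta1_0)
  moreover have "((\<lambda>z. theta1 (2 * z) (2 * \<tau>) * theta4 0 (2 * \<tau>)) has_field_derivative
      2 * deriv (\<lambda>z. theta1 z (2 * \<tau>)) 0 * theta4 0 (2 * \<tau>)) (at 0)"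
    using has_field_derivative_theta1[OF \<tau>2, of "2 * 0"]
    by (auto intro!: derivative_eq_intros DERIV_chain2[where f = "\<lambda>z. theta1 z (2 * \<tau>)"])
  ultimately show ?thesis
    unfolding theta1_theta2[OF assms] by (rule DERIV_unique)
qed

text \<open>In the weight 2 n + 1, the part 2 n comes from the series and the 1 from the prefactor.
  Summability is recorded because the passage to the limit takes it as a hypothesis.\<close>

lemma deriv_theta1_0:
  assumes "Im \<tau> > 0"
  shows "(\<lambda>n. of_real pi * \<i> * of_int (2 * n + 1) * theta_term (\<tau> / 2 + 1 / 2) \<tau> n) summable_on UNIV"
    and "deriv (\<lambda>z. theta1 z \<tau>) 0 = exp (of_real pi * \<i> * \<tau> / 4) *
           (\<Sum>\<^sub>\<infinity>n. of_real pi * \<i> * of_int (2 * n + 1) * theta_term (\<tau> / 2 + 1 / 2) \<tau> n)"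
proof -
  define w where "w = \<tau> / 2 + 1 / 2"
  define T where "T = (\<Sum>\<^sub>\<infinity>n. 2 * of_real pi * \<i> * of_int n * theta_term w \<tau> n)"
  note T = has_field_derivative_theta3[OF assms, of w, folded T_def]
  have split: "of_real pi * \<i> * of_int (2 * n + 1) * theta_term w \<tau> n =
      of_real pi * \<i> * theta_term w \<tau> n + 2 * of_real pi * \<i> * of_int n * theta_term w \<tau> n" for n
    by (simp add: algebra_simps)
  have 1: "(\<lambda>n. of_real pi * \<i> * theta_term w \<tau> n) summable_on UNIV"
    by (intro summable_on_cmult_right theta_term_summable assms)
  show "(\<lambda>n. of_real pi * \<i> * of_int (2 * n + 1) * theta_term w \<tau> n) summable_on UNIV"
    unfolding split by (intro summable_on_add 1 T(1))
  have sum: "(\<Sum>\<^sub>\<infinity>n. of_real pi * \<i> * of_int (2 * n + 1) * theta_term w \<tau> n) = of_real pi * \<i> * theta3 w \<tau> + T"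
    unfolding split by (subst infsum_add[OF 1 T(1)]) (simp add: T_def theta3_altdef infsum_cmult_right')
  have "((\<lambda>z. theta3 (z + w) \<tau>) has_field_derivative T) (at 0)"
    using T(2) DERIV_shift[of "\<lambda>z. theta3 z \<tau>" T 0 w] by simp
  then have "((\<lambda>z. exp (of_real pi * \<i> * \<tau> / 4 + of_real pi * \<i> * z) * theta3 (z + w) \<tau>) has_field_derivative
      exp (of_real pi * \<i> * \<tau> / 4) * (of_real pi * \<i> * theta3 w \<tau> + T)) (at 0)"
    by (auto intro!: derivative_eq_intros simp: algebra_simps)
  then show "deriv (\<lambda>z. theta1 z \<tau>) 0 = exp (of_real pi * \<i> * \<tau> / 4) *
      (\<Sum>\<^sub>\<infinity>n. of_real pi * \<i> * of_int (2 * n + 1) * theta_term w \<tau> n)"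
    unfolding sum by (intro DERIV_imp_deriv) (simp add: theta1_def w_def add_ac)
qed

text \<open>With r = exp (pi i \<tau>), the n-th term is \<open>c n * r ^ (e n * 2 ^ k)\<close>.
  Since |r| < 1, it is dominated by its value at k = 0 and tends to 0 unless
  \<open>e n = 0\<close>.\<close>

lemma theta_sum_limit:
  fixes c :: "int \<Rightarrow> complex" and e :: "int \<Rightarrow> nat"
  assumes "Im \<tau> > 0" "finite {n. e n = 0}"
    and "(\<lambda>n. c n * exp (of_real pi * \<i> * of_nat (e n) * \<tau>)) summable_on UNIV"
  shows "(\<lambda>k. \<Sum>\<^sub>\<infinity>n. c n * exp (of_real pi * \<i> * of_nat (e n) * (2 ^ k * \<tau>))) \<longlonglongrightarrow> (\<Sum>n | e n = 0. c n)"
proof (rule tendsto_infsum_dominated)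
  define r where "r = exp (of_real pi * \<i> * \<tau>)"
  have r: "norm r < 1"
    using assms(1) by (simp add: r_def)
  have exp: "exp (of_real pi * \<i> * of_nat (e n) * (2 ^ k * \<tau>)) = r ^ (e n * 2 ^ k)" for n k
    unfolding r_def exp_of_nat_mult[symmetric] by (simp add: mult_ac)
  show "(\<lambda>n. norm (c n * exp (of_real pi * \<i> * of_nat (e n) * \<tau>))) summable_on UNIV"
    by (rule iffD1[OF summable_on_iff_abs_summable_on_complex assms(3)])
  show "\<forall>\<^sub>F k in sequentially. \<forall>n\<in>UNIV. norm (c n * exp (of_real pi * \<i> * of_nat (e n) * (2 ^ k * \<tau>))) \<le>
          norm (c n * exp (of_real pi * \<i> * of_nat (e n) * \<tau>))"
  proof (intro always_eventually allI ballI)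
    fix k n
    have "norm r ^ (e n * 2 ^ k) \<le> norm r ^ (e n * 2 ^ 0)"
      using r by (intro power_decreasing) auto
    then show "norm (c n * exp (of_real pi * \<i> * of_nat (e n) * (2 ^ k * \<tau>))) \<le>
          norm (c n * exp (of_real pi * \<i> * of_nat (e n) * \<tau>))"
      using exp[of n 0] exp[of n k] by (simp add: norm_mult norm_power mult_left_mono)
  qed
  show "(\<lambda>k. c n * exp (of_real pi * \<i> * of_nat (e n) * (2 ^ k * \<tau>))) \<longlonglongrightarrow> (if e n = 0 then c n else 0)" for n
  proof (cases "e n = 0")
    case False
    have "strict_mono (\<lambda>k. e n * 2 ^ k)"
      using False by (auto intro!: strict_monoI)
    then have "(\<lambda>k. r ^ (e n * 2 ^ k)) \<longlonglongrightarrow> 0"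
      using LIMSEQ_subseq_LIMSEQ[OF LIMSEQ_power_zero[OF r]] by (simp add: o_def)
    from tendsto_mult_right_zero[OF this, of "c n"] show ?thesis
      using False by (simp only: exp if_False)
  qed simp
  show "((\<lambda>n. if e n = 0 then c n else 0) has_sum (\<Sum>n | e n = 0. c n)) UNIV"
    by (rule has_sum_finite_neutralI) (use assms(2) in auto)
qed

lemma Im_power2_mult: "Im (2 ^ k * \<tau>) = 2 ^ k * Im \<tau>"
  by (induction k) (simp_all add: mult.assoc)

text \<open>Only the least exponents survive. For n^2 this is n = 0 alone, hence the limit 1. After
  division by exp (pi i \<tau> / 4), taken at 2^k \<tau>, the other two have exponents n (n + 1),
  which vanish at 0 and at -1. For the derivative the weight 2 n + 1 and the sign (-1)^n are both
  negative at n = -1, so the two contributions add up instead of cancelling.\<close>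

lemma theta_limits:
  assumes "Im \<tau> > 0"
  shows "(\<lambda>k. theta3 0 (2 ^ k * \<tau>)) \<longlonglongrightarrow> 1"
    and "(\<lambda>k. theta4 0 (2 ^ k * \<tau>)) \<longlonglongrightarrow> 1"
    and "(\<lambda>k. theta2 0 (2 ^ k * \<tau>) / exp (of_real pi * \<i> * (2 ^ k * \<tau>) / 4)) \<longlonglongrightarrow> 2"
    and "(\<lambda>k. deriv (\<lambda>z. theta1 z (2 ^ k * \<tau>)) 0 / exp (of_real pi * \<i> * (2 ^ k * \<tau>) / 4)) \<longlonglongrightarrow> 2 * (of_real pi * \<i>)"
proof -
  define s where "s n = nat (n\<^sup>2)" for n :: int
  define e where "e n = nat (n * (n + 1))" for n :: int
  have s: "of_nat (s n) = (of_int n ^ 2 :: complex)" for n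
    by (simp add: s_def)
  have e: "of_nat (e n) = (of_int n ^ 2 + of_int n :: complex)" for n
  proof -
    have "n * (n + 1) \<ge> 0"
      by (cases "n \<ge> 0") (auto simp: zero_le_mult_iff)
    then show ?thesis
      by (simp add: e_def power2_eq_square algebra_simps)
  qed
  have s0: "{n. s n = 0} = {0}"
    by (auto simp: s_def)
  have e0: "{n. e n = 0} = {0, - 1}"
    by (auto simp: e_def mult_le_0_iff)
  have \<tau>k: "Im (2 ^ k * \<tau>) > 0" for k
    using assms by (simp add: Im_power2_mult)
  have 3: "theta_term 0 \<tau> = (\<lambda>n. 1 * exp (of_real pi * \<i> * of_nat (s n) * \<tau>))" for \<tau>
    by (simp add: fun_eq_iff theta_term_def s)
  have 4: "theta_term (1 / 2) \<tau> = (\<lambda>n. exp (of_real pi * \<i> * of_int n) * exp (of_real pi * \<i> * of_nat (s n) * \<tau>))" for \<tau>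
    unfolding theta_term_def s exp_add[symmetric] by (simp add: fun_eq_iff algebra_simps)
  have 2: "theta_term (\<tau> / 2) \<tau> = (\<lambda>n. 1 * exp (of_real pi * \<i> * of_nat (e n) * \<tau>))" for \<tau>
    unfolding theta_term_def e by (simp add: fun_eq_iff algebra_simps)
  have 1: "theta_term (\<tau> / 2 + 1 / 2) \<tau> n = exp (of_real pi * \<i> * of_int n) * exp (of_real pi * \<i> * of_nat (e n) * \<tau>)" for n \<tau>
    unfolding theta_term_def e exp_add[symmetric] by (simp add: algebra_simps)
  have D: "of_real pi * \<i> * of_int (2 * n + 1) * theta_term (\<tau> / 2 + 1 / 2) \<tau> n =
     (of_real pi * \<i> * of_int (2 * n + 1) * exp (of_real pi * \<i> * of_int n)) * exp (of_real pi * \<i> * of_nat (e n) * \<tau>)" for n \<tau>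
    unfolding 1 by (simp only: mult.assoc)
  show "(\<lambda>k. theta3 0 (2 ^ k * \<tau>)) \<longlonglongrightarrow> 1"
    using theta_sum_limit[OF assms, of s "\<lambda>_. 1"] theta_term_summable[OF assms, of 0]
    unfolding theta3_altdef 3 s0 by simp
  show "(\<lambda>k. theta4 0 (2 ^ k * \<tau>)) \<longlonglongrightarrow> 1"
    using theta_sum_limit[OF assms, of s "\<lambda>n. exp (of_real pi * \<i> * of_int n)"] theta_term_summable[OF assms, of "1 / 2"]
    unfolding theta4_def theta3_altdef add_0_left 4 s0 by simp
  have "(\<lambda>k. theta3 (2 ^ k * \<tau> / 2) (2 ^ k * \<tau>)) \<longlonglongrightarrow> 2"
    using theta_sum_limit[OF assms, of e "\<lambda>_. 1"] theta_term_summable[OF assms, of "\<tau> / 2"]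
    unfolding theta3_altdef 2 e0 by simp
  then show "(\<lambda>k. theta2 0 (2 ^ k * \<tau>) / exp (of_real pi * \<i> * (2 ^ k * \<tau>) / 4)) \<longlonglongrightarrow> 2"
    by (simp add: theta2_def)
  have "exp (of_real pi * \<i> * of_int (- 1)) = - 1"
    using exp_minus[of "of_real pi * \<i>"] by simp
  moreover have "(\<Sum>n\<in>{0, - 1}. f n) = f 0 + f (- 1)" for f :: "int \<Rightarrow> complex"
    by simp
  ultimately show "(\<lambda>k. deriv (\<lambda>z. theta1 z (2 ^ k * \<tau>)) 0 / exp (of_real pi * \<i> * (2 ^ k * \<tau>) / 4)) \<longlonglongrightarrow> 2 * (of_real pi * \<i>)"
    using theta_sum_limit[OF assms, of e "\<lambda>n. of_real pi * \<i> * of_int (2 * n + 1) * exp (of_real pi * \<i> * of_int n)"]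
      deriv_theta1_0(1)[OF assms]
    unfolding deriv_theta1_0(2)[OF \<tau>k] D e0 by (simp add: mult_ac)
qed

text \<open>
  The ratio of the two sides of Jacobi's derivative formula does not change when \<open>\<tau>\<close> is doubled, so it
  equals its limit along \<open>2^k \<tau>\<close>. The nonvanishing of the theta constants descends from \<open>2 \<tau>\<close> to \<open>\<tau>\<close>.
\<close>

lemma theta_nonzero_deriv_theta1:
  assumes "Im \<tau> > 0"
  shows "theta2 0 \<tau> \<noteq> 0" "theta3 0 \<tau> \<noteq> 0" "theta4 0 \<tau> \<noteq> 0"
    and "deriv (\<lambda>z. theta1 z \<tau>) 0 = of_real pi * \<i> * theta2 0 \<tau> * theta3 0 \<tau> * theta4 0 \<tau>"
proof -
  define D where "D \<tau> = deriv (\<lambda>z. theta1 z \<tau>) 0" for \<tau>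
  define P where "P \<tau> = theta2 0 \<tau> * theta3 0 \<tau> * theta4 0 \<tau>" for \<tau>
  define t where "t k = 2 ^ k * \<tau>" for k :: nat
  have t: "Im (t k) > 0" "t (Suc k) = 2 * t k" for k
    using assms by (simp_all add: t_def Im_power2_mult)
  define E where "E k = exp (of_real pi * \<i> * t k / 4)" for k
  note lim = theta_limits[OF assms, folded t_def, folded E_def D_def]
  have step: "P \<tau> \<noteq> 0 \<and> D \<tau> / P \<tau> = D (2 * \<tau>) / P (2 * \<tau>)" if "Im \<tau> > 0" "P (2 * \<tau>) \<noteq> 0" for \<tau>
  proof -
    have nz: "theta2 0 (2 * \<tau>) \<noteq> 0" "theta3 0 (2 * \<tau>) \<noteq> 0" "theta4 0 (2 * \<tau>) \<noteq> 0"
      using that(2) by (auto simp: P_def)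
    note * = theta2_0_square[OF that(1)] theta3_theta4_0[OF that(1)] deriv_theta1_double[OF that(1), folded D_def]
    have nz': "theta2 0 \<tau> \<noteq> 0" "theta3 0 \<tau> * theta4 0 \<tau> \<noteq> 0"
      using *(1,2) nz by auto
    \<comment> \<open>The extra factor \<open>theta2 0 \<tau>\<close> makes the doubling rule for
      the derivative applicable; it is nonzero by \<open>nz'\<close> and is cancelled
      afterwards.\<close>
    have "D \<tau> * P (2 * \<tau>) * theta2 0 \<tau> = (D \<tau> * theta2 0 \<tau>) * P (2 * \<tau>)"
      by simp
    also have "\<dots> = D (2 * \<tau>) * (theta2 0 \<tau>)\<^sup>2 * (theta3 0 \<tau> * theta4 0 \<tau>)"
      unfolding * P_def by (simp add: power2_eq_square)
    also have "\<dots> = D (2 * \<tau>) * P \<tau> * theta2 0 \<tau>"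
      by (simp add: P_def power2_eq_square)
    finally have "D \<tau> * P (2 * \<tau>) = D (2 * \<tau>) * P \<tau>"
      using nz' by simp
    then show ?thesis
      using nz' that(2) by (auto simp: P_def frac_eq_eq)
  qed
  \<comment> \<open>Without the division by \<open>E k\<close> the limit would be 0 and say nothing
    about nonvanishing; in the ratio \<open>D / P\<close> the factor cancels.\<close>
  have lim2: "(\<lambda>k. theta2 0 (t k) / E k * theta3 0 (t k) * theta4 0 (t k)) \<longlonglongrightarrow> 2"
    using tendsto_mult[OF tendsto_mult[OF lim(3,1)] lim(2)] by simp
  then have "\<forall>\<^sub>F k in sequentially. theta2 0 (t k) / E k * theta3 0 (t k) * theta4 0 (t k) \<noteq> 0"
    by (rule tendsto_imp_eventually_ne) simp
  then obtain N where N: "P (t N) \<noteq> 0"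
    unfolding eventually_sequentially P_def by auto
  have ratio: "P (t (k + m)) \<noteq> 0 \<Longrightarrow> P (t k) \<noteq> 0 \<and> D (t k) / P (t k) = D (t (k + m)) / P (t (k + m))" for k m
  proof (induction m)
    case (Suc m)
    have "P (2 * t (k + m)) \<noteq> 0"
      using Suc.prems t(2) by simp
    from step[OF t(1) this] show ?case
      using Suc.IH t(2) by simp
  qed simp
  have P: "P \<tau> \<noteq> 0"
    using ratio[of 0 N] N by (simp add: t_def)
  then show "theta2 0 \<tau> \<noteq> 0" "theta3 0 \<tau> \<noteq> 0" "theta4 0 \<tau> \<noteq> 0"
    by (auto simp: P_def)
  have "E k \<noteq> 0" for k
    by (simp add: E_def)
  then have "(\<lambda>k. D (t k) / P (t k)) \<longlonglongrightarrow> of_real pi * \<i>"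
    using tendsto_divide[OF lim(4) lim2] by (simp add: P_def)
  moreover have "\<forall>\<^sub>F k in sequentially. P (t k) \<noteq> 0"
    using \<open>\<forall>\<^sub>F k in sequentially. _ \<noteq> 0\<close> by eventually_elim (auto simp: P_def)
  then have "\<forall>\<^sub>F k in sequentially. D (t k) / P (t k) = D \<tau> / P \<tau>"
    by eventually_elim (use ratio[of 0] in \<open>auto simp: t_def\<close>)
  then have "(\<lambda>k. D (t k) / P (t k)) \<longlonglongrightarrow> D \<tau> / P \<tau>"
    by (rule tendsto_eventually)
  ultimately have "D \<tau> / P \<tau> = of_real pi * \<i>"
    by (rule LIMSEQ_unique[rotated])
  then show "deriv (\<lambda>z. theta1 z \<tau>) 0 = of_real pi * \<i> * theta2 0 \<tau> * theta3 0 \<tau> * theta4 0 \<tau>"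
    using P by (simp add: D_def P_def field_simps)
qed

section \<open>Theta functions of order two\<close>

text \<open>Riemann's theorem on removable singularities, applied in a disc around each point that
  meets \<open>S\<close> at most in its centre. It is stated for a whole discrete set since the
  singularities here form a lattice or a progression of translates.\<close>

lemma holomorphic_extension:
  fixes f :: "complex \<Rightarrow> complex"
  assumes hol: "f holomorphic_on - S"
    and disc: "\<And>z. \<exists>r>0. \<forall>w\<in>S. w \<noteq> z \<longrightarrow> r \<le> dist z w"
    and lim: "\<And>s. s \<in> S \<Longrightarrow> (f \<longlongrightarrow> l s) (at s)"
  shows "(\<lambda>z. if z \<in> S then l z else f z) holomorphic_on UNIV"
proof -
  define h where "h z = (if z \<in> S then l z else f z)" for z
  have "h field_differentiable at z" for z
  proof -
    obtain r where r: "r > 0" "\<forall>w\<in>S. w \<noteq> z \<longrightarrow> r \<le> dist z w"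
      using disc by blast
    have sub: "ball z r - {z} \<subseteq> - S"
      using r(2) by force
    have hol': "h holomorphic_on ball z r - {z}"
      by (rule holomorphic_transform[OF holomorphic_on_subset[OF hol sub]]) (use sub in \<open>auto simp: h_def\<close>)
    have "h holomorphic_on ball z r"
    proof (cases "z \<in> S")
      case True
      show ?thesis
      proof (rule no_isolated_singularity'[OF _ hol'])
        have "\<forall>\<^sub>F w in at z within ball z r. f w = h w"
          using r(1) sub unfolding eventually_at
          by (intro exI[of _ r]) (auto simp: h_def dist_commute)
        moreover have "(f \<longlongrightarrow> h z) (at z within ball z r)"
          using tendsto_within_subset[OF lim[OF True]] True by (simp add: h_def)
        ultimately have "(h \<longlongrightarrow> h z) (at z within ball z r)"
          by (rule Lim_transform_eventually[rotated])
        then show "(h \<longlongrightarrow> h w) (at w within ball z r)" if "w \<in> {z}" for w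
          using that by simp
      qed auto
    next
      case False
      then have sub': "ball z r \<subseteq> - S"
        using sub by blast
      show ?thesis
        by (rule holomorphic_transform[OF holomorphic_on_subset[OF hol sub']]) (use sub' in \<open>auto simp: h_def\<close>)
    qed
    then show ?thesis
      using r(1) by (auto intro: holomorphic_on_imp_differentiable_at)
  qed
  then show ?thesis
    unfolding h_def[symmetric] holomorphic_on_def by (auto intro: field_differentiable_at_within)
qed

section \<open>Fourier coefficients of periodic entire functions\<close>

lemma periodic_of_int:
  fixes f :: "'a::ring_1 \<Rightarrow> 'b"
  assumes "\<And>z. f (z + 1) = f z"
  shows "f (z + of_int n) = f z"
proof (induction n rule: int_induct[where k = 0])
  case (step1 i)
  then show ?case
    using assms[of "z + of_int i"] by (simp add: add_ac)
next
  case (step2 i)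
  then show ?case
    using assms[of "z + of_int i - 1"] by (simp add: add_ac algebra_simps)
qed simp

definition fourier_coeff :: "(complex \<Rightarrow> complex) \<Rightarrow> int \<Rightarrow> complex" where
  "fourier_coeff f n = contour_integral (linepath 0 1) (\<lambda>z. f z * exp (- (2 * of_real pi * \<i> * of_int n * z)))"

text \<open>By periodicity of the integrand the increment \<open>H (z + 1) - H z\<close> has
  derivative 0. Its constancy says that the coefficient may be computed on any translate of the unit
  segment, and replaces a deformation of contours.\<close>

lemma fourier_primitive:
  assumes "f holomorphic_on UNIV" "\<And>z. f (z + 1) = f z"
  obtains H where "\<And>z. (H has_field_derivative f z * exp (- (2 * of_real pi * \<i> * of_int n * z))) (at z)"
    and "\<And>z. H (z + 1) - H z = fourier_coeff f n"
proof -
  have "(\<lambda>z. f z * exp (- (2 * of_real pi * \<i> * of_int n * z))) holomorphic_on UNIV"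
    by (intro holomorphic_intros assms)
  then have "\<exists>H. \<forall>z. (H has_field_derivative f z * exp (- (2 * of_real pi * \<i> * of_int n * z))) (at z)"
    by (rule holomorphic_convex_primitive'[OF convex_UNIV open_UNIV]) (intro exI allI, simp)
  then obtain H where "\<forall>z. (H has_field_derivative f z * exp (- (2 * of_real pi * \<i> * of_int n * z))) (at z)" ..
  then have H: "(H has_field_derivative f z * exp (- (2 * of_real pi * \<i> * of_int n * z))) (at z)" for z
    by (rule spec)
  have "((\<lambda>z. f z * exp (- (2 * of_real pi * \<i> * of_int n * z))) has_contour_integral
      H (pathfinish (linepath 0 1)) - H (pathstart (linepath 0 1))) (linepath 0 1)"
    by (rule contour_integral_primitive[OF H]) auto
  then have coeff: "fourier_coeff f n = H 1 - H 0"
    unfolding fourier_coeff_def by (simp add: contour_integral_unique)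
  have per: "f (z + 1) * exp (- (2 * of_real pi * \<i> * of_int n * (z + 1))) = f z * exp (- (2 * of_real pi * \<i> * of_int n * z))" for z
  proof -
    have "- (2 * of_real pi * \<i> * of_int n * (z + 1)) = - (2 * of_real pi * \<i> * of_int n * z) + 2 * of_real pi * \<i> * of_int (- n)"
      by (simp add: algebra_simps)
    then show ?thesis
      by (simp only: exp_add exp_2pi_i_int assms(2) mult_1_right)
  qed
  have "((\<lambda>z. H (z + 1) - H z) has_field_derivative 0) (at z within UNIV)" for z
  proof -
    have "((\<lambda>z. H (z + 1)) has_field_derivative f (z + 1) * exp (- (2 * of_real pi * \<i> * of_int n * (z + 1)))) (at z)"
      using H[of "z + 1"] by (simp add: DERIV_shift)
    from DERIV_diff[OF this[unfolded per] H[of z]] show ?thesis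
      by simp
  qed
  then have "\<exists>c. \<forall>z\<in>UNIV. H (z + 1) - H z = c"
    by (intro has_field_derivative_zero_constant convex_UNIV)
  then obtain c where "H (z + 1) - H z = c" for z
    by blast
  from this[of 0] this have "\<And>z. H (z + 1) - H z = fourier_coeff f n"
    by (simp add: coeff)
  from that[OF H this] show ?thesis .
qed

lemma has_contour_integral_fourier_coeff:
  assumes "f holomorphic_on UNIV" "\<And>z. f (z + 1) = f z"
  shows "((\<lambda>z. f z * exp (- (2 * of_real pi * \<i> * of_int n * z))) has_contour_integral fourier_coeff f n)
           (linepath a (a + 1))"
proof -
  obtain H where H: "\<And>z. (H has_field_derivative f z * exp (- (2 * of_real pi * \<i> * of_int n * z))) (at z)"
    "\<And>z. H (z + 1) - H z = fourier_coeff f n"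
    by (rule fourier_primitive[OF assms, of n]) (rule that)
  have "((\<lambda>z. f z * exp (- (2 * of_real pi * \<i> * of_int n * z))) has_contour_integral
      H (pathfinish (linepath a (a + 1))) - H (pathstart (linepath a (a + 1)))) (linepath a (a + 1))"
    by (rule contour_integral_primitive[of UNIV]) (use H in auto)
  then show ?thesis
    by (simp add: H(2))
qed

lemma fourier_coeff_eqI:
  "((\<lambda>z. f z * exp (- (2 * of_real pi * \<i> * of_int n * z))) has_contour_integral c) (linepath 0 1) \<Longrightarrow> fourier_coeff f n = c"
  unfolding fourier_coeff_def by (rule contour_integral_unique)

lemma fourier_coeff_lincomb:
  assumes "f holomorphic_on UNIV" "\<And>z. f (z + 1) = f z" "g holomorphic_on UNIV" "\<And>z. g (z + 1) = g z"
  shows "fourier_coeff (\<lambda>z. a * f z + b * g z) n = a * fourier_coeff f n + b * fourier_coeff g n"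
  using has_contour_integral_add[OF
      has_contour_integral_lmul[OF has_contour_integral_fourier_coeff[OF assms(1,2), of n 0], of a]
      has_contour_integral_lmul[OF has_contour_integral_fourier_coeff[OF assms(3,4), of n 0], of b]]
  by (intro fourier_coeff_eqI) (simp add: algebra_simps)

text \<open>The integral is taken along the line Im z = y. The height y is arbitrary, so the
  coefficients decay faster than every exponential in both directions.\<close>

lemma fourier_coeff_bound:
  assumes "f holomorphic_on UNIV" "\<And>z. f (z + 1) = f z"
  obtains M where "M \<ge> 0" "\<And>n. norm (fourier_coeff f n) \<le> M * exp (2 * pi * of_int n * y)"
proof -
  define a where "a = \<i> * of_real y"
  have "compact (f ` closed_segment a (a + 1))"
    by (intro compact_continuous_image holomorphic_on_imp_continuous_on holomorphic_on_subset[OF assms(1)]) auto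
  then obtain M where M: "M > 0" "\<And>z. z \<in> closed_segment a (a + 1) \<Longrightarrow> norm (f z) \<le> M"
    by (metis bounded_pos compact_imp_bounded imageI)
  have Im: "Im z = y" if "z \<in> closed_segment a (a + 1)" for z
    using that by (auto simp: closed_segment_def a_def algebra_simps)
  have "norm (fourier_coeff f n) \<le> M * exp (2 * pi * of_int n * y) * norm (a + 1 - a)" for n
    by (rule has_contour_integral_bound_linepath[OF has_contour_integral_fourier_coeff[OF assms]])
       (use M Im in \<open>auto simp: norm_mult mult_right_mono\<close>)
  then show ?thesis
    using M(1) by (intro that[of M]) auto
qed

text \<open>The coefficient is computed on the unit segment translated by \<tau>, where
  quasi-periodicity turns the integrand into a multiple of the one for the index n + m.\<close>

lemma fourier_coeff_quasi_periodic:
  assumes "f holomorphic_on UNIV" "\<And>z. f (z + 1) = f z"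
    and "\<And>z. f (z + \<tau>) = c * exp (- (2 * of_real pi * \<i> * of_int m * z)) * f z"
  shows "fourier_coeff f n = c * exp (- (2 * of_real pi * \<i> * of_int n * \<tau>)) * fourier_coeff f (n + m)"
proof -
  obtain H where H: "\<And>z. (H has_field_derivative f z * exp (- (2 * of_real pi * \<i> * of_int n * z))) (at z)"
    "\<And>z. H (z + 1) - H z = fourier_coeff f n"
    by (rule fourier_primitive[OF assms(1,2), of n]) (rule that)
  define K where "K z = H (z + \<tau>)" for z
  have "f (z + \<tau>) * exp (- (2 * of_real pi * \<i> * of_int n * (z + \<tau>))) =
      c * exp (- (2 * of_real pi * \<i> * of_int n * \<tau>)) * (f z * exp (- (2 * of_real pi * \<i> * of_int (n + m) * z)))" for z
  proof -
    have "exp (- (2 * of_real pi * \<i> * of_int m * z)) * exp (- (2 * of_real pi * \<i> * of_int n * (z + \<tau>))) =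
      exp (- (2 * of_real pi * \<i> * of_int n * \<tau>)) * exp (- (2 * of_real pi * \<i> * of_int (n + m) * z))"
      unfolding exp_add[symmetric] by (simp add: algebra_simps)
    then show ?thesis
      unfolding assms(3) by (simp add: mult_ac)
  qed
  then have K: "(K has_field_derivative c * exp (- (2 * of_real pi * \<i> * of_int n * \<tau>)) *
      (f z * exp (- (2 * of_real pi * \<i> * of_int (n + m) * z)))) (at z within UNIV)" for z
    unfolding K_def using H(1)[of "z + \<tau>"] by (simp only: DERIV_shift)
  have "((\<lambda>z. c * exp (- (2 * of_real pi * \<i> * of_int n * \<tau>)) *
      (f z * exp (- (2 * of_real pi * \<i> * of_int (n + m) * z)))) has_contour_integral
      K (pathfinish (linepath 0 1)) - K (pathstart (linepath 0 1))) (linepath 0 1)"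
    by (rule contour_integral_primitive[of UNIV, OF K valid_path_linepath]) simp
  moreover have "K 1 - K 0 = fourier_coeff f n"
    using H(2)[of \<tau>] by (simp add: K_def add_ac)
  ultimately have "((\<lambda>z. c * exp (- (2 * of_real pi * \<i> * of_int n * \<tau>)) *
      (f z * exp (- (2 * of_real pi * \<i> * of_int (n + m) * z)))) has_contour_integral fourier_coeff f n) (linepath 0 1)"
    by simp
  moreover have "((\<lambda>z. c * exp (- (2 * of_real pi * \<i> * of_int n * \<tau>)) *
      (f z * exp (- (2 * of_real pi * \<i> * of_int (n + m) * z)))) has_contour_integral
      c * exp (- (2 * of_real pi * \<i> * of_int n * \<tau>)) * fourier_coeff f (n + m)) (linepath 0 1)"
    using has_contour_integral_lmul[OF has_contour_integral_fourier_coeff[OF assms(1,2), of "n + m" 0]] by simp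
  ultimately show ?thesis
    by (rule has_contour_integral_unique)
qed

lemma fourier_coeff_1: "fourier_coeff (\<lambda>_. 1) n = (if n = 0 then 1 else 0)"
proof (cases "n = 0")
  case True
  have "((\<lambda>z. 1) has_contour_integral 1) (linepath 0 (1::complex))"
    using has_contour_integral_const_linepath[where c = 1 and a = 0 and b = 1] by simp
  then show ?thesis
    using True by (intro fourier_coeff_eqI) simp
next
  case False
  \<comment> \<open>A constant has every number as a period. With the period \<i>, the coefficient
    equals itself times exp (2 pi n), which differs from 1 for n \<noteq> 0.\<close>
  have "fourier_coeff (\<lambda>_. 1) n = 1 * exp (- (2 * of_real pi * \<i> * of_int n * \<i>)) * fourier_coeff (\<lambda>_. 1) (n + 0)"
    by (rule fourier_coeff_quasi_periodic) auto
  moreover have "exp (- (2 * of_real pi * \<i> * of_int n * \<i>)) = of_real (exp (2 * pi * of_int n))"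
    unfolding exp_of_real[symmetric] by (rule arg_cong[of _ _ exp]) (simp add: complex_eq_iff)
  moreover have "exp (2 * pi * of_int n) \<noteq> (1 :: real)"
    using False by simp
  ultimately show ?thesis
    using False by (metis add.right_neutral mult.left_neutral mult_cancel_right2 of_real_eq_1_iff)
qed

text \<open>
  Dividing \<open>f - f z0\<close> by \<open>exp (2 \<pi> \<i> z) - exp (2 \<pi> \<i> z0)\<close> gives an entire periodic function
  whose Fourier coefficients satisfy a first-order recurrence, so growth forces them to vanish.
\<close>

lemma fourier_coeff_unique:
  assumes f: "f holomorphic_on UNIV" "\<And>z. f (z + 1) = f z" and coeff: "\<And>n. fourier_coeff f n = 0"
  shows "f z0 = 0"
proof -
  define e where "e z = exp (2 * of_real pi * \<i> * z)" for z
  define S where "S = {z. e z = e z0}"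
  \<comment> \<open>By periodicity f - f z0 vanishes on all of \<open>S\<close>, where e - e z0 has
    simple zeros. The value on \<open>S\<close> is the limit of the quotient, the ratio of the two
    derivatives.\<close>
  define k where "k z = (if z \<in> S then deriv f z / (2 * of_real pi * \<i> * e z) else (f z - f z0) / (e z - e z0))" for z
  have S: "z \<in> S \<longleftrightarrow> (\<exists>n. z = z0 + of_int n)" for z
  proof -
    have "2 * of_real pi * \<i> * z = 2 * of_real pi * \<i> * z0 + of_int (2 * n) * of_real pi * \<i> \<longleftrightarrow> z = z0 + of_int n" for n
    proof -
      have "2 * of_real pi * \<i> * z0 + of_int (2 * n) * of_real pi * \<i> = 2 * of_real pi * \<i> * (z0 + of_int n)"
        by (simp add: algebra_simps)
      then show ?thesis
        by simp
    qed
    then show ?thesis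
      unfolding S_def e_def mem_Collect_eq exp_eq by (simp add: mult_ac)
  qed
  have e1: "e (z + 1) = e z" for z
    using exp_2pi_i_int[of 1] by (simp add: e_def distrib_left exp_add)
  have S1: "z + 1 \<in> S \<longleftrightarrow> z \<in> S" for z
    by (simp add: S_def e1)
  have fS: "f s = f z0" if "s \<in> S" for s
    using that periodic_of_int[of f, OF f(2)] by (auto simp: S)
  have disc: "\<exists>r>0. \<forall>w\<in>S. w \<noteq> z \<longrightarrow> r \<le> dist z w" for z
  proof -
    have "finite (S \<inter> cball z 1)"
    proof -
      have "finite {n::int. \<bar>of_int n - Re (z - z0)\<bar> \<le> 1}"
      proof (rule finite_subset)
        show "{n::int. \<bar>of_int n - Re (z - z0)\<bar> \<le> 1} \<subseteq> {\<lfloor>Re (z - z0)\<rfloor> - 1..\<lceil>Re (z - z0)\<rceil> + 1}"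
          by auto linarith+
      qed simp
      moreover have "S \<inter> cball z 1 \<subseteq> (\<lambda>n. z0 + of_int n) ` {n::int. \<bar>of_int n - Re (z - z0)\<bar> \<le> 1}"
      proof
        fix w assume "w \<in> S \<inter> cball z 1"
        then obtain n where n: "w = z0 + of_int n" "norm (w - z) \<le> 1"
          by (auto simp: S dist_norm norm_minus_commute)
        then have "\<bar>of_int n - Re (z - z0)\<bar> \<le> 1"
          using abs_Re_le_cmod[of "w - z"] by (simp add: algebra_simps)
        with n show "w \<in> (\<lambda>n. z0 + of_int n) ` {n::int. \<bar>of_int n - Re (z - z0)\<bar> \<le> 1}"
          by blast
      qed
      ultimately show ?thesis
        by (meson finite_imageI finite_subset)
    qed
    from finite_set_avoid[OF this, of z] obtain d where d: "d > 0" "\<forall>x\<in>S \<inter> cball z 1. x \<noteq> z \<longrightarrow> d \<le> dist z x"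
      by blast
    then show ?thesis
      by (intro exI[of _ "min d 1"]) force
  qed
  have e_deriv: "(e has_field_derivative 2 * of_real pi * \<i> * e z) (at z)" for z
    unfolding e_def by (auto intro!: derivative_eq_intros)
  have k_hol: "k holomorphic_on UNIV"
    unfolding k_def
  proof (rule holomorphic_extension[OF _ disc])
    show "(\<lambda>z. (f z - f z0) / (e z - e z0)) holomorphic_on - S"
      unfolding e_def by (intro holomorphic_intros holomorphic_on_subset[OF f(1)]) (auto simp: S_def e_def)
    fix s assume s: "s \<in> S"
    have "(f has_field_derivative deriv f s) (at s)"
      using f(1) by (rule holomorphic_derivI) auto
    then have "((\<lambda>z. (f z - f s) / (z - s)) \<longlongrightarrow> deriv f s) (at s)"
      unfolding has_field_derivative_iff .
    moreover have "((\<lambda>z. (e z - e s) / (z - s)) \<longlongrightarrow> 2 * of_real pi * \<i> * e s) (at s)"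
      using e_deriv[of s] unfolding has_field_derivative_iff .
    ultimately have "((\<lambda>z. ((f z - f s) / (z - s)) / ((e z - e s) / (z - s))) \<longlongrightarrow> deriv f s / (2 * of_real pi * \<i> * e s)) (at s)"
      by (rule tendsto_divide) (simp add: e_def)
    moreover have "\<forall>\<^sub>F z in at s. ((f z - f s) / (z - s)) / ((e z - e s) / (z - s)) = (f z - f z0) / (e z - e z0)"
      proof -
      have "((f z - f s) / (z - s)) / ((e z - e s) / (z - s)) = (f z - f z0) / (e z - e z0)" if "z \<noteq> s" for z
        using that fS[OF s] s by (simp add: S_def)
      then show ?thesis
        unfolding eventually_at_filter by (intro always_eventually) blast
    qed
    ultimately show "((\<lambda>z. (f z - f z0) / (e z - e z0)) \<longlongrightarrow> deriv f s / (2 * of_real pi * \<i> * e s)) (at s)"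
      by (rule Lim_transform_eventually)
  qed
  have k1: "k (z + 1) = k z" for z
  proof -
    have "((\<lambda>w. f (w + 1)) has_field_derivative deriv f (z + 1)) (at z)"
      using holomorphic_derivI[OF f(1), of "z + 1" UNIV] by (simp add: DERIV_shift)
    then have "deriv f (z + 1) = deriv f z"
      unfolding f(2) by (rule DERIV_imp_deriv[symmetric])
    then show ?thesis
      by (simp add: k_def S1 e1 f(2))
  qed
  have ek: "e z * k z - e z0 * k z = f z - f z0" for z
    using fS[of z] by (auto simp: k_def S_def field_simps)
  define d where "d n = fourier_coeff k n" for n
  \<comment> \<open>Multiplication by e shifts the index by one. The coefficients of f vanish by
    assumption, so the right side comes from the constant f z0 alone; index 0 is therefore the only
    place where f z0 enters, through d 0 and d (-1).\<close>
  have rec: "d (n - 1) - e z0 * d n = (if n = 0 then - f z0 else 0)" for n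
  proof -
    have "((\<lambda>z. k z * exp (- (2 * of_real pi * \<i> * of_int (n - 1) * z)) - e z0 * (k z * exp (- (2 * of_real pi * \<i> * of_int n * z))))
        has_contour_integral d (n - 1) - e z0 * d n) (linepath 0 1)"
      using has_contour_integral_diff[OF has_contour_integral_fourier_coeff[OF k_hol k1, of "n - 1" 0]
          has_contour_integral_lmul[OF has_contour_integral_fourier_coeff[OF k_hol k1, of n 0], of "e z0"]]
      by (simp add: d_def)
    moreover have "k z * exp (- (2 * of_real pi * \<i> * of_int (n - 1) * z)) - e z0 * (k z * exp (- (2 * of_real pi * \<i> * of_int n * z))) =
        (1 * f z + (- f z0) * 1) * exp (- (2 * of_real pi * \<i> * of_int n * z))" for z
    proof -
      have "exp (- (2 * of_real pi * \<i> * of_int (n - 1) * z)) = e z * exp (- (2 * of_real pi * \<i> * of_int n * z))"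
        unfolding e_def exp_add[symmetric] by (simp add: algebra_simps)
      then show ?thesis
        using arg_cong[OF ek[of z], of "\<lambda>w. w * exp (- (2 * of_real pi * \<i> * of_int n * z))"]
        by (simp add: algebra_simps)
    qed
    ultimately have "fourier_coeff (\<lambda>z. 1 * f z + (- f z0) * 1) n = d (n - 1) - e z0 * d n"
      by (intro fourier_coeff_eqI) simp
    moreover have "fourier_coeff (\<lambda>z. 1 * f z + (- f z0) * 1) n = 1 * fourier_coeff f n + (- f z0) * fourier_coeff (\<lambda>_. 1) n"
      by (rule fourier_coeff_lincomb) (use f in auto)
    ultimately show ?thesis
      by (simp add: coeff fourier_coeff_1)
  qed
  define y where "y = Im z0"
  have norm_e: "norm (e z0) = exp (- (2 * pi * y))"
    by (simp add: e_def y_def)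
  have vanish: "c = 0" if "\<And>m::nat. norm c \<le> M * exp (- (2 * pi * real m))" for c :: complex and M
  proof -
    have "(\<lambda>m. M * exp (- (2 * pi)) ^ m) \<longlonglongrightarrow> M * 0"
      by (intro tendsto_mult tendsto_const LIMSEQ_power_zero) simp
    moreover have "exp (- (2 * pi)) ^ m = exp (- (2 * pi * real m))" for m
      unfolding exp_of_nat_mult[symmetric] by (simp add: mult_ac)
    ultimately have "(\<lambda>m. M * exp (- (2 * pi * real m))) \<longlonglongrightarrow> 0"
      by simp
    from LIMSEQ_le_const[OF this, of "norm c"] that show ?thesis
      by auto
  qed
  have "d 0 = 0"
  proof -
    have d: "d 0 = e z0 ^ m * d (int m)" for m
    proof (induction m)
      case (Suc m)
      then show ?case
        using rec[of "int (Suc m)"] by (simp add: mult_ac)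
    qed simp
    \<comment> \<open>The bound is taken one unit below the height y of z0: the powers of e z0
      cancel the part with y, and exp (-2 pi m) remains. For negative indices the line one unit
      above does the same.\<close>
    obtain M where "M \<ge> 0" and M: "\<And>n. norm (d n) \<le> M * exp (2 * pi * of_int n * (y - 1))"
      by (rule fourier_coeff_bound[OF k_hol k1, of "y - 1", folded d_def]) (rule that)
    have "norm (d 0) \<le> M * exp (- (2 * pi * real m))" for m
    proof -
      have "norm (d 0) \<le> exp (- (2 * pi * y)) ^ m * (M * exp (2 * pi * real m * (y - 1)))"
        using M[of "int m"] unfolding d[of m] norm_mult norm_power norm_e by (intro mult_left_mono) auto
      also have "\<dots> = M * (exp (real m * (- (2 * pi * y))) * exp (2 * pi * real m * (y - 1)))"
        unfolding exp_of_nat_mult by (simp only: mult_ac)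
      also have "exp (real m * (- (2 * pi * y))) * exp (2 * pi * real m * (y - 1)) = exp (- (2 * pi * real m))"
        unfolding exp_add[symmetric] by (simp add: algebra_simps)
      finally show ?thesis .
    qed
    then show ?thesis
      by (rule vanish)
  qed
  moreover have "d (- 1) = 0"
  proof -
    have d: "d (- 1 - int m) = e z0 ^ m * d (- 1)" for m
    proof (induction m)
      case (Suc m)
      then show ?case
        using rec[of "- 1 - int m"] by (simp add: algebra_simps)
    qed simp
    obtain M where "M \<ge> 0" and M: "\<And>n. norm (d n) \<le> M * exp (2 * pi * of_int n * (y + 1))"
      by (rule fourier_coeff_bound[OF k_hol k1, of "y + 1", folded d_def]) (rule that)
    have "norm (d (- 1)) \<le> (M * exp (- (2 * pi * (y + 1)))) * exp (- (2 * pi * real m))" for m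
    proof -
      have "exp (real m * (2 * pi * y)) * exp (- (2 * pi * y)) ^ m = 1"
        unfolding exp_of_nat_mult[symmetric] exp_add[symmetric] by simp
      then have "norm (d (- 1)) = exp (real m * (2 * pi * y)) * norm (d (- 1 - int m))"
        unfolding d[of m] norm_mult norm_power norm_e by (simp flip: mult.assoc)
      also have "\<dots> \<le> exp (real m * (2 * pi * y)) * (M * exp (2 * pi * of_int (- 1 - int m) * (y + 1)))"
        by (intro mult_left_mono M) simp
      also have "\<dots> = M * (exp (real m * (2 * pi * y)) * exp (2 * pi * of_int (- 1 - int m) * (y + 1)))"
        by simp
      also have "exp (real m * (2 * pi * y)) * exp (2 * pi * of_int (- 1 - int m) * (y + 1)) =
          exp (- (2 * pi * (y + 1))) * exp (- (2 * pi * real m))"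
        unfolding exp_add[symmetric] by (simp add: algebra_simps)
      finally show ?thesis
        by simp
    qed
    then show ?thesis
      by (rule vanish)
  qed
  ultimately show ?thesis
    using rec[of 0] by simp
qed

section \<open>The space of theta functions of order two\<close>

definition theta_space :: "complex \<Rightarrow> (complex \<Rightarrow> complex) set" where
  "theta_space \<tau> = {f. f holomorphic_on UNIV \<and> (\<forall>z. f (z + 1) = f z) \<and>
     (\<forall>z. f (z + \<tau>) = exp (- (2 * of_real pi * \<i> * \<tau>)) * exp (- (2 * of_real pi * \<i> * of_int 2 * z)) * f z)}"

lemma theta_space_lincomb:
  "f \<in> theta_space \<tau> \<Longrightarrow> g \<in> theta_space \<tau> \<Longrightarrow> (\<lambda>z. a * f z + b * g z) \<in> theta_space \<tau>"
  unfolding theta_space_def by (auto intro!: holomorphic_intros simp: distrib_left distrib_right mult_ac)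

text \<open>The multiplier is the square of that of a theta function, so quasi-periodicity links the
  coefficients n and n + 2 by a nonzero factor. The coefficients 0 and 1 thus determine all others,
  one for each parity.\<close>

lemma theta_space_eq_0:
  assumes f: "f \<in> theta_space \<tau>" and 01: "fourier_coeff f 0 = 0" "fourier_coeff f 1 = 0"
  shows "f z = 0"
proof -
  have hol: "f holomorphic_on UNIV" and per: "\<And>z. f (z + 1) = f z"
    and quasi: "\<And>z. f (z + \<tau>) = exp (- (2 * of_real pi * \<i> * \<tau>)) * exp (- (2 * of_real pi * \<i> * of_int 2 * z)) * f z"
    using f by (auto simp: theta_space_def)
  have step: "fourier_coeff f n = 0 \<longleftrightarrow> fourier_coeff f (n + 2) = 0" for n
    using fourier_coeff_quasi_periodic[OF hol per quasi, of n] by simp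
  have even_odd: "fourier_coeff f (r + 2 * q) = 0" if "fourier_coeff f r = 0" for q r
  proof (induction q rule: int_induct[where k = 0])
    case (step1 i)
    then show ?case
      using step[of "r + 2 * i"] by (simp add: algebra_simps)
  next
    case (step2 i)
    then show ?case
      using step[of "r + 2 * (i - 1)"] by (simp add: algebra_simps)
  qed (simp add: that)
  have "fourier_coeff f n = 0" for n
  proof (cases "even n")
    case True
    then show ?thesis
      using even_odd[OF 01(1), of "n div 2"] by simp
  next
    case False
    then have "1 + 2 * (n div 2) = n"
      by presburger
    then show ?thesis
      using even_odd[OF 01(2), of "n div 2"] by simp
  qed
  then show ?thesis
    by (rule fourier_coeff_unique[OF hol per])
qed

text \<open>The map to the coefficients 0 and 1 is injective on the space. Two independent functions
  therefore have independent coefficient pairs, and Cramer's rule expresses any third pair by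
  them.\<close>

lemma theta_space_span:
  assumes f: "f \<in> theta_space \<tau>" and g: "g \<in> theta_space \<tau>" and h: "h \<in> theta_space \<tau>"
    and indep: "\<And>a b. (\<And>z. a * g z + b * h z = 0) \<Longrightarrow> a = 0 \<and> b = 0"
  obtains a b where "\<And>z. f z = a * g z + b * h z"
proof -
  note hp = f[unfolded theta_space_def, simplified] g[unfolded theta_space_def, simplified] h[unfolded theta_space_def, simplified]
  define g0 g1 h0 h1 where "g0 = fourier_coeff g 0" and "g1 = fourier_coeff g 1"
    and "h0 = fourier_coeff h 0" and "h1 = fourier_coeff h 1"
  note defs = g0_def g1_def h0_def h1_def
  have comb: "fourier_coeff (\<lambda>z. a * g z + b * h z) n = a * fourier_coeff g n + b * fourier_coeff h n" for a b n
    using hp by (intro fourier_coeff_lincomb) auto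
  have indep': "a = 0 \<and> b = 0" if "a * g0 + b * h0 = 0" "a * g1 + b * h1 = 0" for a b
    by (rule indep, rule theta_space_eq_0[OF theta_space_lincomb[OF g h]])
       (use that in \<open>simp_all only: comb defs\<close>)
  have det: "g0 * h1 - g1 * h0 \<noteq> 0"
  proof
    assume "g0 * h1 - g1 * h0 = 0"
    \<comment> \<open>If the determinant vanishes, (h0, -g0) and (h1, -g1) are both linear relations
      between g and h, so independence kills all four coefficients.\<close>
    then have "h0 = 0 \<and> g0 = 0" "h1 = 0 \<and> g1 = 0"
      using indep'[of h0 "- g0"] indep'[of h1 "- g1"] by (simp_all add: algebra_simps)
    then show False
      using indep'[of 1 0] by simp
  qed
  define f0 f1 where "f0 = fourier_coeff f 0" and "f1 = fourier_coeff f 1"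
  define a b where "a = (f0 * h1 - f1 * h0) / (g0 * h1 - g1 * h0)" and "b = (g0 * f1 - g1 * f0) / (g0 * h1 - g1 * h0)"
  have ab: "f0 = a * g0 + b * h0" "f1 = a * g1 + b * h1"
    using det unfolding a_def b_def by (simp_all add: divide_simps) (simp_all add: algebra_simps)
  have mem: "(\<lambda>z. a * g z + b * h z) \<in> theta_space \<tau>"
    by (rule theta_space_lincomb[OF g h])
  have "1 * f z + (- 1) * (a * g z + b * h z) = 0" for z
  proof (rule theta_space_eq_0[OF theta_space_lincomb[OF f mem]])
    have "fourier_coeff (\<lambda>z. 1 * f z + (- 1) * (a * g z + b * h z)) n =
        1 * fourier_coeff f n + (- 1) * fourier_coeff (\<lambda>z. a * g z + b * h z) n" for n
      using hp mem[unfolded theta_space_def, simplified] by (intro fourier_coeff_lincomb) auto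
    then show "fourier_coeff (\<lambda>z. 1 * f z + (- 1) * (a * g z + b * h z)) 0 = 0"
      "fourier_coeff (\<lambda>z. 1 * f z + (- 1) * (a * g z + b * h z)) 1 = 0"
      using ab by (simp_all only: comb defs f0_def f1_def) simp_all
  qed
  then have "f z = a * g z + b * h z" for z
    by (simp only: mult_1 mult_minus1 eq_iff_diff_eq_0[of "f z"] diff_conv_add_uminus)
  then show ?thesis
    by (rule that)
qed

section \<open>The Weierstrass function\<close>

locale normalized_lattice =
  fixes \<tau> :: complex
  assumes Im_pos: "Im \<tau> > 0"
begin

abbreviation L :: "complex set" where "L \<equiv> period_lattice 1 \<tau>"
abbreviation L0 :: "complex set" where "L0 \<equiv> L - {0}"

lemma in_L: "z \<in> L \<longleftrightarrow> (\<exists>m n. z = of_int m + of_int n * \<tau>)"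
  by (simp add: period_lattice_def)

lemma L_0: "0 \<in> L" and L_1: "1 \<in> L" and L_tau: "\<tau> \<in> L"
proof -
  show "0 \<in> L"
    unfolding in_L by (intro exI[of _ 0]) simp
  show "1 \<in> L"
    unfolding in_L by (intro exI[of _ 1] exI[of _ 0]) simp
  show "\<tau> \<in> L"
    unfolding in_L by (intro exI[of _ 0] exI[of _ 1]) simp
qed

lemma L_add: "z \<in> L \<Longrightarrow> w \<in> L \<Longrightarrow> z + w \<in> L"
proof -
  assume "z \<in> L" "w \<in> L"
  then obtain m n m' n' where "z = of_int m + of_int n * \<tau>" "w = of_int m' + of_int n' * \<tau>"
    unfolding in_L by blast
  then have "z + w = of_int (m + m') + of_int (n + n') * \<tau>"
    by (simp add: algebra_simps)
  then show ?thesis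
    unfolding in_L by blast
qed

lemma L_minus: "z \<in> L \<Longrightarrow> - z \<in> L"
proof -
  assume "z \<in> L"
  then obtain m n where "z = of_int m + of_int n * \<tau>"
    unfolding in_L by blast
  then have "- z = of_int (- m) + of_int (- n) * \<tau>"
    by simp
  then show ?thesis
    unfolding in_L by blast
qed

lemma L_diff: "z \<in> L \<Longrightarrow> w \<in> L \<Longrightarrow> z - w \<in> L"
  using L_add[of z "- w"] L_minus[of w] by simp

lemma L_minus_iff: "- z \<in> L \<longleftrightarrow> z \<in> L"
  using L_minus[of z] L_minus[of "- z"] by auto

lemma L_add_iff: "w \<in> L \<Longrightarrow> z + w \<in> L \<longleftrightarrow> z \<in> L"
  using L_add[of z w] L_diff[of "z + w" w] by auto

lemma real_coords_unique:
  "of_real x + of_real y * \<tau> = of_real x' + of_real y' * \<tau> \<longleftrightarrow> x = x' \<and> y = y'"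
  using Im_pos by (auto simp: complex_eq_iff)

lemma in_L_real_coords: "of_real x + of_real y * \<tau> \<in> L \<longleftrightarrow> x \<in> \<int> \<and> y \<in> \<int>"
proof -
  have "of_real x + of_real y * \<tau> \<in> L \<longleftrightarrow>
      (\<exists>m n. of_real x + of_real y * \<tau> = of_real (of_int m) + of_real (of_int n) * \<tau>)"
    by (simp add: in_L)
  then show ?thesis
    unfolding real_coords_unique by (auto elim!: Ints_cases)
qed

text \<open>The second coordinate of a lattice point w is at most |w| / Im \<tau>, the first at most
  |w| (1 + |\<tau>| / Im \<tau>). The sum of these two factors serves for both.\<close>

definition coord_bound :: real where "coord_bound = 1 + (1 + norm \<tau>) / Im \<tau>"

lemma coords_le:
  "\<bar>real_of_int n\<bar> \<le> coord_bound * norm (of_int m + of_int n * \<tau>)"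
  "\<bar>real_of_int m\<bar> \<le> coord_bound * norm (of_int m + of_int n * \<tau>)"
proof -
  define w where "w = of_int m + of_int n * \<tau>"
  have "\<bar>of_int n * Im \<tau>\<bar> \<le> norm w"
    using abs_Im_le_cmod[of w] by (simp add: w_def)
  then have n: "\<bar>real_of_int n\<bar> \<le> norm w / Im \<tau>"
    using Im_pos by (simp add: abs_mult pos_le_divide_eq)
  also have "\<dots> \<le> coord_bound * norm w"
    using Im_pos by (simp add: coord_bound_def field_simps)
  finally show "\<bar>real_of_int n\<bar> \<le> coord_bound * norm (of_int m + of_int n * \<tau>)"
    by (simp add: w_def)
  have "of_int m = w - of_int n * \<tau>"
    by (simp add: w_def)
  then have "\<bar>real_of_int m\<bar> = norm (w - of_int n * \<tau>)"
    by (metis norm_of_int)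
  also have "\<dots> \<le> norm w + \<bar>real_of_int n\<bar> * norm \<tau>"
    using norm_triangle_ineq4[of w "of_int n * \<tau>"] by (simp add: norm_mult)
  also have "\<dots> \<le> norm w + norm w / Im \<tau> * norm \<tau>"
    using n by (intro add_left_mono mult_right_mono) auto
  also have "\<dots> \<le> norm w + norm w / Im \<tau> * norm \<tau> + norm w / Im \<tau>"
    using Im_pos by simp
  also have "\<dots> = coord_bound * norm w"
    by (simp add: coord_bound_def add_divide_distrib algebra_simps)
  finally show "\<bar>real_of_int m\<bar> \<le> coord_bound * norm (of_int m + of_int n * \<tau>)"
    by (simp add: w_def)
qed

lemma coord_bound_pos: "coord_bound > 0"
  using Im_pos by (auto simp: coord_bound_def intro!: add_pos_nonneg)

lemma finite_L_ball: "finite {\<omega> \<in> L. norm \<omega> \<le> R}"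
proof -
  define N where "N = \<lceil>coord_bound * R\<rceil>"
  have "{\<omega> \<in> L. norm \<omega> \<le> R} \<subseteq> (\<lambda>(m, n). of_int m + of_int n * \<tau>) ` ({- N..N} \<times> {- N..N})"
  proof
    fix \<omega> assume "\<omega> \<in> {\<omega> \<in> L. norm \<omega> \<le> R}"
    then obtain m n where mn: "\<omega> = of_int m + of_int n * \<tau>" and R: "norm \<omega> \<le> R"
      unfolding in_L by blast
    have "coord_bound * norm \<omega> \<le> coord_bound * R"
      using R coord_bound_pos by simp
    then have "\<bar>real_of_int m\<bar> \<le> coord_bound * R" "\<bar>real_of_int n\<bar> \<le> coord_bound * R"
      using coords_le[of n m] coords_le[of m n] unfolding mn by linarith+
    then have "m \<in> {- N..N}" "n \<in> {- N..N}"
      unfolding N_def by (auto; linarith)+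
    then show "\<omega> \<in> (\<lambda>(m, n). of_int m + of_int n * \<tau>) ` ({- N..N} \<times> {- N..N})"
      using mn by (intro image_eqI[of _ _ "(m, n)"]) auto
  qed
  then show ?thesis
    by (rule finite_subset) auto
qed

lemma L_discrete: "\<exists>r>0. \<forall>\<omega>\<in>L. \<omega> \<noteq> z \<longrightarrow> r \<le> dist z \<omega>"
proof -
  from finite_set_avoid[OF finite_L_ball[of "norm z + 1"], of z]
  obtain d where d: "d > 0" "\<forall>x\<in>{\<omega> \<in> L. norm \<omega> \<le> norm z + 1}. x \<noteq> z \<longrightarrow> d \<le> dist z x"
    by blast
  have "min d 1 \<le> dist z \<omega>" if "\<omega> \<in> L" "\<omega> \<noteq> z" for \<omega>
  proof (cases "norm \<omega> \<le> norm z + 1")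
    case True
    then show ?thesis
      using d(2) that by auto
  next
    case False
    then show ?thesis
      using norm_triangle_ineq2[of \<omega> z] by (simp add: dist_norm norm_minus_commute)
  qed
  then show ?thesis
    using d(1) by (intro exI[of _ "min d 1"]) auto
qed

lemma closed_subset_L:
  assumes "A \<subseteq> L"
  shows "closed A"
  unfolding closed_limpt
proof (intro allI impI)
  fix z assume z: "z islimpt A"
  obtain r where r: "r > 0" "\<forall>\<omega>\<in>L. \<omega> \<noteq> z \<longrightarrow> r \<le> dist z \<omega>"
    using L_discrete by blast
  from z r(1) obtain w where "w \<in> A" "w \<noteq> z" "dist w z < r"
    unfolding islimpt_approachable by blast
  then show "z \<in> A"
    using r(2) assms by (force simp: dist_commute)
qed

lemma open_Compl_L: "open (- L)" "open (- L0)"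
  by (simp_all only: open_closed double_complement closed_subset_L Diff_subset order_refl)

lemma countable_L: "countable L"
proof -
  have "L = (\<lambda>(m, n). of_int m + of_int n * \<tau>) ` UNIV"
    by (auto simp: period_lattice_def image_iff)
  then show ?thesis
    by simp
qed

text \<open>Up to a constant, |m| and |n| are bounded by the norm of the lattice point. Splitting
  the exponent 3 evenly as 3/2 + 3/2 bounds the terms by a product of two convergent one-dimensional
  series.\<close>

lemma summable_norm_cube: "(\<lambda>\<omega>. 1 / norm \<omega> ^ 3) summable_on L0"
proof -
  \<comment> \<open>As 0 powr x is 0, the index 0 is given the value 1 by hand; it bounds w powr
    (-3/2) because w \<ge> 1 away from the origin.\<close>
  define g where "g n = (if n = 0 then 1 else real n powr (- 3 / 2))" for n :: nat
  have "summable (\<lambda>n. real n powr (- 3 / 2))"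
    by (subst summable_real_powr_iff) simp
  then have "summable g"
    by (rule summable_cong[THEN iffD1, rotated]) (auto simp: g_def intro!: eventually_sequentiallyI[of 1])
  then have g: "(\<lambda>n::int. norm (g (nat \<bar>n\<bar>))) summable_on UNIV"
    using summable_on_int_abs[of g] by (simp add: g_def)
  have prod: "(\<lambda>p. coord_bound ^ 3 * norm (case p of (m, n) \<Rightarrow> g (nat \<bar>m\<bar>) * g (nat \<bar>n\<bar>))) summable_on UNIV - {(0, 0)}"
    by (intro summable_on_cmult_right summable_on_subset_banach[OF infsum_product(1)[OF g g]]) simp
  have "(\<lambda>p. 1 / norm (case p of (m, n) \<Rightarrow> of_int m + of_int n * \<tau>) ^ 3) summable_on UNIV - {(0, 0)}"
  proof (rule summable_on_comparison_test[OF prod])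
    fix p :: "int \<times> int" assume p: "p \<in> UNIV - {(0, 0)}"
    obtain m n where mn: "p = (m, n)"
      by (cases p)
    define w where "w = coord_bound * norm (of_int m + of_int n * \<tau>)"
    have bound: "\<bar>real_of_int m\<bar> \<le> w" "\<bar>real_of_int n\<bar> \<le> w"
      using coords_le[of n m] coords_le[of m n] by (auto simp: w_def)
    have w1: "w \<ge> 1"
    proof (cases "m = 0")
      case True
      then have "\<bar>real_of_int n\<bar> \<ge> 1"
        using p mn by auto
      then show ?thesis
        using bound by linarith
    next
      case False
      then have "\<bar>real_of_int m\<bar> \<ge> 1"
        by auto
      then show ?thesis
        using bound by linarith
    qed
    have "w powr (- 3 / 2) \<le> g (nat \<bar>k\<bar>)" if "\<bar>real_of_int k\<bar> \<le> w" for k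
    proof (cases "k = 0")
      case True
      then show ?thesis
        using w1 powr_mono2'[of "- 3 / 2" 1 w] by (simp add: g_def)
    next
      case False
      then show ?thesis
        using that powr_mono2'[of "- 3 / 2" "\<bar>real_of_int k\<bar>" w] by (simp add: g_def)
    qed
    then have "w powr (- 3 / 2) * w powr (- 3 / 2) \<le> g (nat \<bar>m\<bar>) * g (nat \<bar>n\<bar>)"
      using bound by (intro mult_mono) (auto simp: g_def)
    moreover have "w powr (- 3 / 2) * w powr (- 3 / 2) = 1 / w ^ 3"
      using w1 by (simp add: powr_minus_divide powr_numeral flip: powr_add)
    ultimately have "coord_bound ^ 3 * (1 / w ^ 3) \<le> coord_bound ^ 3 * (g (nat \<bar>m\<bar>) * g (nat \<bar>n\<bar>))"
      using coord_bound_pos by (intro mult_left_mono) auto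
    moreover have "1 / norm (of_int m + of_int n * \<tau>) ^ 3 = coord_bound ^ 3 * (1 / w ^ 3)"
      using coord_bound_pos by (simp add: w_def power_mult_distrib)
    moreover have "norm (g (nat \<bar>m\<bar>) * g (nat \<bar>n\<bar>)) = g (nat \<bar>m\<bar>) * g (nat \<bar>n\<bar>)"
      by (simp add: g_def)
    ultimately show "1 / norm (case p of (m, n) \<Rightarrow> of_int m + of_int n * \<tau>) ^ 3 \<le>
        coord_bound ^ 3 * norm (case p of (m, n) \<Rightarrow> g (nat \<bar>m\<bar>) * g (nat \<bar>n\<bar>))"
      by (simp only: mn case_prod_conv)
  qed simp
  moreover have "inj_on (\<lambda>(m, n). of_int m + of_int n * \<tau>) (UNIV - {(0, 0)})"
  proof (rule inj_onI)
    fix p q :: "int \<times> int"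
    assume "(case p of (m, n) \<Rightarrow> of_int m + of_int n * \<tau>) = (case q of (m, n) \<Rightarrow> of_int m + of_int n * \<tau>)"
    then show "p = q"
      using real_coords_unique[of "of_int (fst p)" "of_int (snd p)" "of_int (fst q)" "of_int (snd q)"]
      by (simp add: case_prod_unfold prod_eq_iff)
  qed
  moreover have "L0 = (\<lambda>(m, n). of_int m + of_int n * \<tau>) ` (UNIV - {(0, 0)})"
  proof -
    have "of_int m + of_int n * \<tau> = 0 \<longleftrightarrow> m = 0 \<and> n = 0" for m n
      using real_coords_unique[of "of_int m" "of_int n" 0 0] by simp
    then have L0: "z \<in> L0 \<longleftrightarrow> (\<exists>m n. (m, n) \<noteq> (0, 0) \<and> z = of_int m + of_int n * \<tau>)" for z
      unfolding Diff_iff in_L by auto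
    show ?thesis
    proof (rule Set.set_eqI)
      fix z
      show "z \<in> L0 \<longleftrightarrow> z \<in> (\<lambda>(m, n). of_int m + of_int n * \<tau>) ` (UNIV - {(0, 0)})"
        unfolding L0 by (auto simp: image_iff Bex_def)
    qed
  qed
  ultimately show ?thesis
    by (subst \<open>L0 = _\<close>, subst summable_on_reindex) (auto simp: o_def case_prod_unfold)
qed

lemma norm_L0_lower: "\<exists>\<rho>>0. \<forall>\<omega>\<in>L0. \<rho> \<le> norm \<omega>"
  using L_discrete[of 0] by auto

text \<open>For large \<omega> the triangle inequality gives the factor 1/2. The remaining \<omega>
  have bounded norm and keep a positive distance from the compact disc. This makes majorants uniform
  on discs.\<close>

lemma dist_L0_lower:
  assumes "cball z0 r \<subseteq> - L0"
  obtains c where "c > 0" "\<And>\<omega> z. \<omega> \<in> L0 \<Longrightarrow> z \<in> cball z0 r \<Longrightarrow> c * norm \<omega> \<le> norm (z - \<omega>)"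
proof -
  have "\<exists>d>0. \<forall>x\<in>cball z0 r. \<forall>y\<in>L0. d \<le> dist x y"
    by (rule separate_compact_closed) (use assms closed_subset_L in auto)
  then obtain d where d: "d > 0" "\<And>x y. x \<in> cball z0 r \<Longrightarrow> y \<in> L0 \<Longrightarrow> d \<le> dist x y"
    by blast
  define R where "R = norm z0 + \<bar>r\<bar> + 1"
  have R: "R > 0"
    by (auto simp: R_def intro: add_nonneg_pos)
  define c where "c = min (1 / 2) (d / (2 * R))"
  show ?thesis
  proof (rule that)
    show "c > 0"
      using d(1) R by (simp add: c_def)
    fix \<omega> z assume \<omega>: "\<omega> \<in> L0" and z: "z \<in> cball z0 r"
    have zR: "norm z \<le> R"
      using z norm_triangle_ineq2[of z z0] by (auto simp: R_def dist_norm norm_minus_commute)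
    show "c * norm \<omega> \<le> norm (z - \<omega>)"
    proof (cases "norm \<omega> \<le> 2 * R")
      case True
      have "c * norm \<omega> \<le> d / (2 * R) * (2 * R)"
        using True d(1) R by (intro mult_mono) (auto simp: c_def)
      also have "\<dots> \<le> norm (z - \<omega>)"
        using d(2)[OF z \<omega>] R by (simp add: dist_norm)
      finally show ?thesis .
    next
      case False
      have "c * norm \<omega> \<le> 1 / 2 * norm \<omega>"
        by (intro mult_right_mono) (auto simp: c_def)
      also have "\<dots> \<le> norm (z - \<omega>)"
        using False zR norm_triangle_ineq2[of \<omega> z] by (simp add: norm_minus_commute)
      finally show ?thesis .
    qed
  qed
qed

lemma summable_on_L0I:
  fixes f :: "complex \<Rightarrow> complex"
  assumes "\<And>\<omega>. \<omega> \<in> L0 \<Longrightarrow> norm (f \<omega>) \<le> C * (1 / norm \<omega> ^ 3)"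
  shows "f summable_on L0"
proof (rule abs_summable_summable)
  show "(\<lambda>\<omega>. norm (f \<omega>)) summable_on L0"
    by (rule summable_on_comparison_test[OF summable_on_cmult_right[OF summable_norm_cube, of C]])
       (use assms in auto)
qed

section \<open>Eisenstein sums and the expansion at the origin\<close>

definition G :: "nat \<Rightarrow> complex" where "G k = (\<Sum>\<^sub>\<infinity>\<omega>\<in>L0. 1 / \<omega> ^ k)"

lemma summable_G:
  assumes "k \<ge> 3"
  shows "(\<lambda>\<omega>. 1 / \<omega> ^ k) summable_on L0"
proof -
  obtain \<rho> where \<rho>: "\<rho> > 0" "\<forall>\<omega>\<in>L0. \<rho> \<le> norm \<omega>"
    using norm_L0_lower by blast
  show ?thesis
  proof (rule summable_on_L0I)
    fix \<omega> assume "\<omega> \<in> L0"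
    then have "norm \<omega> > 0" "\<rho> \<le> norm \<omega>"
      using \<rho> by auto
    then have "1 / norm \<omega> ^ (k - 3) \<le> 1 / \<rho> ^ (k - 3)"
      using \<rho>(1) by (intro frac_le power_mono) auto
    then have "1 / norm \<omega> ^ (k - 3) * (1 / norm \<omega> ^ 3) \<le> 1 / \<rho> ^ (k - 3) * (1 / norm \<omega> ^ 3)"
      by (rule mult_right_mono) simp
    moreover have "norm \<omega> ^ k = norm \<omega> ^ (k - 3) * norm \<omega> ^ 3"
      using assms by (simp flip: power_add)
    ultimately show "norm (1 / \<omega> ^ k) \<le> 1 / \<rho> ^ (k - 3) * (1 / norm \<omega> ^ 3)"
      by (simp add: norm_divide norm_power)
  qed
qed

lemma infsum_L0_minus:
  fixes f :: "complex \<Rightarrow> complex"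
  shows "(\<Sum>\<^sub>\<infinity>\<omega>\<in>L0. f (- \<omega>)) = (\<Sum>\<^sub>\<infinity>\<omega>\<in>L0. f \<omega>)"
  by (rule infsum_reindex_bij_witness[of _ uminus uminus]) (auto simp: L_minus_iff)

lemma G_odd: "odd k \<Longrightarrow> G k = 0"
  using infsum_L0_minus[of "\<lambda>\<omega>. 1 / \<omega> ^ k"]
  by (simp add: G_def infsum_uminus)

text \<open>The Weierstrass function without its pole 1 / z^2 at the origin, hence holomorphic
  there.\<close>

definition wp0 :: "complex \<Rightarrow> complex" where
  "wp0 z = (\<Sum>\<^sub>\<infinity>\<omega>\<in>L0. 1 / (z - \<omega>) ^ 2 - 1 / \<omega> ^ 2)"

text \<open>The remainder after the terms of degree at most 4 in the Taylor series of \<open>wp0\<close>, divided by \<open>z^5\<close>.\<close>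

definition wp0_rem :: "complex \<Rightarrow> complex" where
  "wp0_rem z = (\<Sum>\<^sub>\<infinity>\<omega>\<in>L0. (6 * \<omega> - 5 * z) / (\<omega> ^ 6 * (z - \<omega>) ^ 2))"

text \<open>Subtracting 1 / \<omega>^2 cancels the leading order and leaves |\<omega>|^(-3). The
  numerator 2 \<omega> - z is written as \<omega> - (z - \<omega>), so that only the norms a and b
  of \<omega> and z - \<omega> appear.\<close>

lemma wp0_term_bound:
  fixes z \<omega> :: complex
  assumes "c > 0" "\<omega> \<noteq> 0" "c * norm \<omega> \<le> norm (z - \<omega>)" "norm z \<le> R"
  shows "norm (1 / (z - \<omega>) ^ 2 - 1 / \<omega> ^ 2) \<le> R * (1 / c ^ 2 + 1 / c) * (1 / norm \<omega> ^ 3)"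
proof -
  define a b where "a = norm \<omega>" and "b = norm (z - \<omega>)"
  have a: "a > 0" and b: "c * a \<le> b"
    using assms by (auto simp: a_def b_def)
  have "b > 0"
    using a b assms(1) by (meson mult_pos_pos less_le_trans)
  then have "z \<noteq> \<omega>"
    by (auto simp: b_def)
  then have "1 / (z - \<omega>) ^ 2 - 1 / \<omega> ^ 2 = z * ((\<omega> - (z - \<omega>)) / ((z - \<omega>) ^ 2 * \<omega> ^ 2))"
    using assms(2) by (simp add: divide_simps) (simp add: power2_eq_square algebra_simps)
  then have "norm (1 / (z - \<omega>) ^ 2 - 1 / \<omega> ^ 2) = norm z * (norm (\<omega> - (z - \<omega>)) / (b ^ 2 * a ^ 2))"
    by (simp add: norm_mult norm_divide norm_power a_def b_def)
  also have "\<dots> \<le> R * ((a + b) / (b ^ 2 * a ^ 2))"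
    using assms(4) norm_triangle_ineq4[of \<omega> "z - \<omega>"]
    by (intro mult_mono divide_right_mono) (auto simp: a_def b_def intro: order_trans[OF norm_ge_zero])
  also have "(a + b) / (b ^ 2 * a ^ 2) = 1 / (b ^ 2 * a) + 1 / (b * a ^ 2)"
    using a \<open>b > 0\<close> by (simp add: divide_simps) (simp add: power2_eq_square algebra_simps)
  also have "\<dots> \<le> 1 / ((c * a) ^ 2 * a) + 1 / ((c * a) * a ^ 2)"
    using a b assms(1) by (intro add_mono frac_le mult_right_mono power_mono) auto
  also have "\<dots> = (1 / c ^ 2 + 1 / c) * (1 / a ^ 3)"
    using a assms(1) by (simp add: divide_simps) (simp add: power2_eq_square power3_eq_cube algebra_simps)
  finally show ?thesis
    using assms(4) order_trans[OF norm_ge_zero assms(4)] by (simp add: a_def mult.assoc mult_left_mono)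
qed

text \<open>As before, with 6 \<omega> - 5 z = \<omega> - 5 (z - \<omega>). The terms decay like
  |\<omega>|^(-7); four of these powers are given away to \<rho>, so that the majorant
  |\<omega>|^(-3) serves again.\<close>

lemma wp0_rem_term_bound:
  fixes z \<omega> :: complex
  assumes "c > 0" "\<rho> > 0" "\<rho> \<le> norm \<omega>" "c * norm \<omega> \<le> norm (z - \<omega>)"
  shows "norm ((6 * \<omega> - 5 * z) / (\<omega> ^ 6 * (z - \<omega>) ^ 2)) \<le> (1 / c ^ 2 + 5 / c) / \<rho> ^ 4 * (1 / norm \<omega> ^ 3)"
proof -
  define a b where "a = norm \<omega>" and "b = norm (z - \<omega>)"
  have a: "a > 0" "\<rho> \<le> a" and b: "c * a \<le> b"
    using assms by (auto simp: a_def b_def)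
  have "b > 0"
    using a b assms(1) by (meson mult_pos_pos less_le_trans)
  have "norm (6 * \<omega> - 5 * z) = norm (\<omega> - 5 * (z - \<omega>))"
    by (simp add: algebra_simps)
  also have "\<dots> \<le> norm \<omega> + norm (5 * (z - \<omega>))"
    by (rule norm_triangle_ineq4)
  also have "\<dots> = a + 5 * b"
    unfolding norm_mult a_def b_def by simp
  finally have "norm (6 * \<omega> - 5 * z) \<le> a + 5 * b" .
  then have "norm ((6 * \<omega> - 5 * z) / (\<omega> ^ 6 * (z - \<omega>) ^ 2)) \<le> (a + 5 * b) / (a ^ 6 * b ^ 2)"
    by (simp add: norm_mult norm_divide norm_power a_def b_def divide_right_mono)
  also have "\<dots> = 1 / (a ^ 5 * b ^ 2) + 5 / (a ^ 6 * b)"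
  proof -
    have "a ^ 6 = a * a ^ 5" "b ^ 2 = b * b"
      by (simp_all add: eval_nat_numeral)
    then show ?thesis
      using a \<open>b > 0\<close> by (simp add: add_divide_distrib)
  qed
  also have "\<dots> \<le> 1 / (a ^ 5 * (c * a) ^ 2) + 5 / (a ^ 6 * (c * a))"
    using a b assms(1) by (intro add_mono frac_le mult_left_mono power_mono) auto
  also have "\<dots> = (1 / c ^ 2 + 5 / c) * (1 / a ^ 3) * (1 / a ^ 4)"
  proof -
    have *: "a ^ 5 * (c * a) ^ 2 = c ^ 2 * (a ^ 3 * a ^ 4)" "a ^ 6 * (c * a) = c * (a ^ 3 * a ^ 4)"
      by (simp_all add: eval_nat_numeral mult_ac)
    show ?thesis
      unfolding * by (simp add: distrib_right add_divide_distrib mult.assoc)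
  qed
  also have "\<dots> \<le> (1 / c ^ 2 + 5 / c) * (1 / a ^ 3) * (1 / \<rho> ^ 4)"
    using a assms(1,2) by (intro mult_left_mono frac_le power_mono) auto
  finally show ?thesis
    by (simp add: a_def mult_ac)
qed

lemma has_field_derivative_wp0:
  assumes "z \<in> - L0"
  shows "(\<lambda>\<omega>. - 2 / (z - \<omega>) ^ 3) summable_on L0"
    and "(wp0 has_field_derivative (\<Sum>\<^sub>\<infinity>\<omega>\<in>L0. - 2 / (z - \<omega>) ^ 3)) (at z)"
proof -
  have deriv: "((\<lambda>z. 1 / (z - \<omega>) ^ 2 - 1 / \<omega> ^ 2) has_field_derivative - 2 / (z - \<omega>) ^ 3) (at z)"
    if "\<omega> \<in> L0" "z \<in> - L0" for z \<omega>
  proof -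
    have "z - \<omega> \<noteq> 0"
      using that by auto
    then have "((\<lambda>z. 1 / (z - \<omega>) ^ 2) has_field_derivative - 2 / (z - \<omega>) ^ 3) (at z)"
      by (auto intro!: derivative_eq_intros simp: divide_simps eval_nat_numeral)
    from DERIV_diff[OF this DERIV_const[of "1 / \<omega> ^ 2"]] show ?thesis
      by simp
  qed
  have bound: "\<exists>M. M summable_on L0 \<and> (\<forall>\<omega>\<in>L0. \<forall>y\<in>cball z r. norm (1 / (y - \<omega>) ^ 2 - 1 / \<omega> ^ 2) \<le> M \<omega>)"
    if "cball z r \<subseteq> - L0" for r
  proof -
    obtain c where c: "c > 0" "\<And>\<omega> y. \<omega> \<in> L0 \<Longrightarrow> y \<in> cball z r \<Longrightarrow> c * norm \<omega> \<le> norm (y - \<omega>)"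
      using dist_L0_lower[OF \<open>cball z r \<subseteq> - L0\<close>] by blast
    show ?thesis
    proof (intro exI conjI ballI)
      show "(\<lambda>\<omega>. (norm z + r) * (1 / c ^ 2 + 1 / c) * (1 / norm \<omega> ^ 3)) summable_on L0"
        by (intro summable_on_cmult_right summable_norm_cube)
      fix \<omega> y assume "\<omega> \<in> L0" "y \<in> cball z r"
      moreover from this have "norm y \<le> norm z + r"
        using norm_triangle_ineq2[of y z] by (simp add: dist_norm norm_minus_commute)
      ultimately show "norm (1 / (y - \<omega>) ^ 2 - 1 / \<omega> ^ 2) \<le> (norm z + r) * (1 / c ^ 2 + 1 / c) * (1 / norm \<omega> ^ 3)"
        using c by (intro wp0_term_bound) auto
    qed
  qed
  note * = has_field_derivative_infsum[OF open_Compl_L(2) assms deriv bound]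
  show "(\<lambda>\<omega>. - 2 / (z - \<omega>) ^ 3) summable_on L0"
    by (rule *(1))
  show "(wp0 has_field_derivative (\<Sum>\<^sub>\<infinity>\<omega>\<in>L0. - 2 / (z - \<omega>) ^ 3)) (at z)"
    using *(2) by (simp add: wp0_def[abs_def])
qed

lemma wp0_rem_holomorphic: "wp0_rem holomorphic_on - L0"
proof -
  obtain \<rho> where \<rho>: "\<rho> > 0" "\<forall>\<omega>\<in>L0. \<rho> \<le> norm \<omega>"
    using norm_L0_lower by blast
  define g where "g \<omega> z = (6 * \<omega> - 5 * z) / (\<omega> ^ 6 * (z - \<omega>) ^ 2)" for \<omega> z :: complex
  have deriv: "(g \<omega> has_field_derivative deriv (g \<omega>) z) (at z)" if "\<omega> \<in> L0" "z \<in> - L0" for z \<omega>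
  proof (rule holomorphic_derivI[OF _ open_Compl_L(2) that(2)])
    show "g \<omega> holomorphic_on - L0"
      unfolding g_def using that(1) by (intro holomorphic_intros) auto
  qed
  have bound: "\<exists>M. M summable_on L0 \<and> (\<forall>\<omega>\<in>L0. \<forall>y\<in>cball z r. norm (g \<omega> y) \<le> M \<omega>)"
    if "cball z r \<subseteq> - L0" for z r
  proof -
    obtain c where c: "c > 0" "\<And>\<omega> y. \<omega> \<in> L0 \<Longrightarrow> y \<in> cball z r \<Longrightarrow> c * norm \<omega> \<le> norm (y - \<omega>)"
      using dist_L0_lower[OF \<open>cball z r \<subseteq> - L0\<close>] by blast
    show ?thesis
    proof (intro exI conjI ballI)
      show "(\<lambda>\<omega>. (1 / c ^ 2 + 5 / c) / \<rho> ^ 4 * (1 / norm \<omega> ^ 3)) summable_on L0"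
        by (intro summable_on_cmult_right summable_norm_cube)
      show "norm (g \<omega> y) \<le> (1 / c ^ 2 + 5 / c) / \<rho> ^ 4 * (1 / norm \<omega> ^ 3)" if "\<omega> \<in> L0" "y \<in> cball z r" for \<omega> y
        unfolding g_def using that c \<rho> by (intro wp0_rem_term_bound) auto
    qed
  qed
  have "(wp0_rem has_field_derivative (\<Sum>\<^sub>\<infinity>\<omega>\<in>L0. deriv (g \<omega>) z)) (at z)" if "z \<in> - L0" for z
    using has_field_derivative_infsum(2)[OF open_Compl_L(2) that deriv bound]
    by (simp add: wp0_rem_def[abs_def] g_def[abs_def])
  then show ?thesis
    unfolding holomorphic_on_open[OF open_Compl_L(2)] by blast
qed

text \<open>Taylor expansion of (z - \<omega>)^(-2). Degree 4 is the right place to stop: in the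
  cube of the Weierstrass function the expansion is multiplied by z^(-4), so z^4 is the last power
  that reaches the constant term of the differential equation.\<close>

lemma wp0_term_expansion:
  fixes z \<omega> :: complex
  assumes "\<omega> \<noteq> 0" "z \<noteq> \<omega>"
  shows "1 / (z - \<omega>) ^ 2 - 1 / \<omega> ^ 2 =
    2 * z * (1 / \<omega> ^ 3) + 3 * z ^ 2 * (1 / \<omega> ^ 4) + 4 * z ^ 3 * (1 / \<omega> ^ 5) + 5 * z ^ 4 * (1 / \<omega> ^ 6) +
    z ^ 5 * ((6 * \<omega> - 5 * z) / (\<omega> ^ 6 * (z - \<omega>) ^ 2))"
proof -
  define d where "d = z - \<omega>"
  have d: "d \<noteq> 0" and z: "z = d + \<omega>"
    using assms by (auto simp: d_def)
  define N where "N = \<omega> ^ 6 * d ^ 2"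
  have N: "N \<noteq> 0"
    using d assms by (simp add: N_def)
  have poly: "\<omega> ^ 6 - \<omega> ^ 4 * d ^ 2 =
      2 * z * (\<omega> ^ 3 * d ^ 2) + 3 * z ^ 2 * (\<omega> ^ 2 * d ^ 2) + 4 * z ^ 3 * (\<omega> * d ^ 2) + 5 * z ^ 4 * d ^ 2 + z ^ 5 * (6 * \<omega> - 5 * z)"
    unfolding z by (simp add: eval_nat_numeral algebra_simps)
  have frac: "1 / d ^ 2 = \<omega> ^ 6 / N" "1 / \<omega> ^ 2 = \<omega> ^ 4 * d ^ 2 / N" "1 / \<omega> ^ 3 = \<omega> ^ 3 * d ^ 2 / N"
    "1 / \<omega> ^ 4 = \<omega> ^ 2 * d ^ 2 / N" "1 / \<omega> ^ 5 = \<omega> * d ^ 2 / N" "1 / \<omega> ^ 6 = d ^ 2 / N"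
    using d assms(1) unfolding N_def by (simp_all add: frac_eq_eq eval_nat_numeral)
  show ?thesis
    unfolding d_def[symmetric] N_def[symmetric] frac
    using poly by (simp flip: add_divide_distrib diff_divide_distrib)
qed

lemma summable_wp0_rem_term:
  assumes "z \<in> - L0"
  shows "(\<lambda>\<omega>. (6 * \<omega> - 5 * z) / (\<omega> ^ 6 * (z - \<omega>) ^ 2)) summable_on L0"
proof -
  obtain \<rho> where \<rho>: "\<rho> > 0" "\<forall>\<omega>\<in>L0. \<rho> \<le> norm \<omega>"
    using norm_L0_lower by blast
  have "cball z 0 \<subseteq> - L0"
    using assms by simp
  then obtain c where c: "c > 0" "\<And>\<omega> y. \<omega> \<in> L0 \<Longrightarrow> y \<in> cball z 0 \<Longrightarrow> c * norm \<omega> \<le> norm (y - \<omega>)"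
    by (rule dist_L0_lower) blast
  show ?thesis
  proof (rule summable_on_L0I)
    show "norm ((6 * \<omega> - 5 * z) / (\<omega> ^ 6 * (z - \<omega>) ^ 2)) \<le> (1 / c ^ 2 + 5 / c) / \<rho> ^ 4 * (1 / norm \<omega> ^ 3)"
      if "\<omega> \<in> L0" for \<omega>
      using that c \<rho> by (intro wp0_rem_term_bound) auto
  qed
qed

text \<open>The odd powers up to degree 4 drop out by the symmetry of the lattice under
  negation.\<close>

lemma wp0_expansion:
  assumes "z \<in> - L0"
  shows "wp0 z = 3 * G 4 * z ^ 2 + 5 * G 6 * z ^ 4 + z ^ 5 * wp0_rem z"
proof -
  have G: "((\<lambda>\<omega>. 1 / \<omega> ^ k) has_sum G k) L0" if "k \<ge> 3" for k
    using summable_G[OF that] by (simp add: G_def)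
  have rem: "((\<lambda>\<omega>. (6 * \<omega> - 5 * z) / (\<omega> ^ 6 * (z - \<omega>) ^ 2)) has_sum wp0_rem z) L0"
    using summable_wp0_rem_term[OF assms] by (simp add: wp0_rem_def)
  have "((\<lambda>\<omega>. 2 * z * (1 / \<omega> ^ 3) + 3 * z ^ 2 * (1 / \<omega> ^ 4) + 4 * z ^ 3 * (1 / \<omega> ^ 5) + 5 * z ^ 4 * (1 / \<omega> ^ 6) +
      z ^ 5 * ((6 * \<omega> - 5 * z) / (\<omega> ^ 6 * (z - \<omega>) ^ 2))) has_sum
      2 * z * G 3 + 3 * z ^ 2 * G 4 + 4 * z ^ 3 * G 5 + 5 * z ^ 4 * G 6 + z ^ 5 * wp0_rem z) L0"
    by (intro has_sum_add has_sum_cmult_right G rem) auto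
  then have "infsum (\<lambda>\<omega>. 2 * z * (1 / \<omega> ^ 3) + 3 * z ^ 2 * (1 / \<omega> ^ 4) + 4 * z ^ 3 * (1 / \<omega> ^ 5) + 5 * z ^ 4 * (1 / \<omega> ^ 6) +
      z ^ 5 * ((6 * \<omega> - 5 * z) / (\<omega> ^ 6 * (z - \<omega>) ^ 2))) L0 =
      2 * z * G 3 + 3 * z ^ 2 * G 4 + 4 * z ^ 3 * G 5 + 5 * z ^ 4 * G 6 + z ^ 5 * wp0_rem z"
    by (rule infsumI)
  moreover have "wp0 z = infsum (\<lambda>\<omega>. 2 * z * (1 / \<omega> ^ 3) + 3 * z ^ 2 * (1 / \<omega> ^ 4) + 4 * z ^ 3 * (1 / \<omega> ^ 5) + 5 * z ^ 4 * (1 / \<omega> ^ 6) +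
      z ^ 5 * ((6 * \<omega> - 5 * z) / (\<omega> ^ 6 * (z - \<omega>) ^ 2))) L0"
    unfolding wp0_def
  proof (rule infsum_cong, rule wp0_term_expansion)
    fix \<omega> assume "\<omega> \<in> L0"
    then show "\<omega> \<noteq> 0" "z \<noteq> \<omega>"
      using assms by auto
  qed
  ultimately show ?thesis
    by (simp add: G_odd mult_ac)
qed

text \<open>The value 0 at the poles makes the periodicity of \<open>wp\<close> unconditional.\<close>

definition wp :: "complex \<Rightarrow> complex" where
  "wp z = (if z \<in> L then 0 else 1 / z ^ 2 + wp0 z)"

text \<open>The sum runs over the whole lattice, so periodicity is a mere reindexing. At a lattice
  point the singular term is 0, because division by zero gives 0.\<close>

definition wp' :: "complex \<Rightarrow> complex" where
  "wp' z = (\<Sum>\<^sub>\<infinity>\<omega>\<in>L. - 2 / (z - \<omega>) ^ 3)"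

lemma wp'_eq:
  assumes "z \<notin> L"
  shows "wp' z = - 2 / z ^ 3 + deriv wp0 z"
proof -
  have z: "z \<in> - L0"
    using assms by simp
  have "((\<lambda>\<omega>. - 2 / (z - \<omega>) ^ 3) has_sum - 2 / (z - 0) ^ 3 + (\<Sum>\<^sub>\<infinity>\<omega>\<in>L0. - 2 / (z - \<omega>) ^ 3)) (insert 0 L0)"
    by (rule has_sum_insert) (use has_field_derivative_wp0(1)[OF z] in auto)
  moreover have "insert 0 L0 = L"
    using L_0 by blast
  ultimately show ?thesis
    using DERIV_imp_deriv[OF has_field_derivative_wp0(2)[OF z]] by (simp add: wp'_def infsumI)
qed

lemma has_field_derivative_wp:
  assumes "z \<notin> L"
  shows "(wp has_field_derivative wp' z) (at z)"
proof -
  have z: "z \<in> - L0" "z \<noteq> 0"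
    using assms L_0 by auto
  have "((\<lambda>z. 1 / z ^ 2) has_field_derivative - 2 / z ^ 3) (at z)"
    using z(2) by (auto intro!: derivative_eq_intros simp: divide_simps eval_nat_numeral)
  moreover have "(wp0 has_field_derivative deriv wp0 z) (at z)"
    using has_field_derivative_wp0(2)[OF z(1)] by (metis DERIV_imp_deriv)
  ultimately have "((\<lambda>z. 1 / z ^ 2 + wp0 z) has_field_derivative wp' z) (at z)"
    unfolding wp'_eq[OF assms] by (rule DERIV_add)
  then show ?thesis
    by (rule has_field_derivative_transform_within_open[OF _ open_Compl_L(1)]) (use assms in \<open>auto simp: wp_def\<close>)
qed

section \<open>Periodicity and parity\<close>

lemma wp'_periodic:
  assumes "\<omega> \<in> L"
  shows "wp' (z + \<omega>) = wp' z"
  unfolding wp'_def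
  by (rule infsum_reindex_bij_witness[of _ "\<lambda>\<eta>. \<eta> + \<omega>" "\<lambda>\<eta>. \<eta> - \<omega>"])
     (use assms in \<open>auto simp: L_add L_diff algebra_simps\<close>)

lemma wp'_minus: "wp' (- z) = - wp' z"
proof -
  have "wp' (- z) = (\<Sum>\<^sub>\<infinity>\<omega>\<in>L. - (- 2 / (z - \<omega>) ^ 3))"
    unfolding wp'_def
  proof (rule infsum_reindex_bij_witness[of _ uminus uminus])
    fix \<omega>
    have 1: "- z - \<omega> = - (z + \<omega>)" "z - - \<omega> = z + \<omega>"
      by simp_all
    have 2: "(- (z + \<omega>)) ^ 3 = - ((z + \<omega>) ^ 3)"
      by (rule power_minus_odd) simp
    show "- (- 2 / (z - - \<omega>) ^ 3) = - 2 / (- z - \<omega>) ^ 3"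
      unfolding 1 2 by simp
  qed (auto simp: L_minus_iff)
  then show ?thesis
    by (simp only: infsum_uminus wp'_def)
qed

lemma wp_minus: "wp (- z) = wp z"
proof -
  have "(- z - - \<omega>) ^ 2 = (z - \<omega>) ^ 2" for \<omega>
    by (simp add: power2_eq_square algebra_simps)
  then have "wp0 (- z) = wp0 z"
    using infsum_L0_minus[of "\<lambda>\<omega>. 1 / (- z - \<omega>) ^ 2 - 1 / \<omega> ^ 2"] by (simp add: wp0_def)
  then show ?thesis
    by (simp add: wp_def L_minus_iff)
qed

text \<open>The difference of the two sides has derivative 0 on the complement of the countable
  lattice, which is connected. Its constant value is read off at -\<omega>/2, where evenness makes
  it 0; hence the condition that \<omega>/2 is no pole.\<close>

lemma wp_periodic_aux:
  assumes "\<omega> \<in> L" "\<omega> / 2 \<notin> L"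
  shows "wp (z + \<omega>) = wp z"
proof (cases "z \<in> L")
  case True
  then show ?thesis
    using assms by (simp add: wp_def L_add_iff)
next
  case False
  have deriv: "((\<lambda>z. wp (z + \<omega>) - wp z) has_field_derivative 0) (at z)" if "z \<notin> L" for z
  proof -
    have "((\<lambda>z. wp (z + \<omega>)) has_field_derivative wp' z) (at z)"
      using has_field_derivative_wp[of "z + \<omega>"] that assms by (simp add: DERIV_shift L_add_iff wp'_periodic)
    from DERIV_diff[OF this has_field_derivative_wp[OF that]] show ?thesis
      by simp
  qed
  have "connected (UNIV - L)"
    by (rule connected_open_diff_countable) (auto simp: countable_L)
  then have conn: "connected (- L)"
    by (simp add: Compl_eq_Diff_UNIV)
  have cont: "continuous_on (- L) (\<lambda>z. wp (z + \<omega>) - wp z)"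
    using deriv by (intro continuous_at_imp_continuous_on ballI DERIV_isCont) auto
  obtain c where c: "\<And>z. z \<in> - L \<Longrightarrow> wp (z + \<omega>) - wp z = c"
    using DERIV_zero_connected_constant[OF conn open_Compl_L(1) finite.emptyI cont] deriv by auto
  have "- (\<omega> / 2) \<in> - L"
    using assms(2) by (simp add: L_minus_iff)
  from c[OF this] have "c = 0"
    using wp_minus[of "\<omega> / 2"] by simp
  then show ?thesis
    using c[of z] False by simp
qed

lemma half_periods: "1 / 2 \<notin> L" "\<tau> / 2 \<notin> L" "(1 + \<tau>) / 2 \<notin> L"
proof -
  have half: "(1 / 2 :: real) \<notin> \<int>"
    using of_int_eq_iff by (auto elim!: Ints_cases simp: field_simps)
  have "of_real (1 / 2) + of_real 0 * \<tau> \<notin> L" "of_real 0 + of_real (1 / 2) * \<tau> \<notin> L"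
    "of_real (1 / 2) + of_real (1 / 2) * \<tau> \<notin> L"
    unfolding in_L_real_coords using half by auto
  then show "1 / 2 \<notin> L" "\<tau> / 2 \<notin> L" "(1 + \<tau>) / 2 \<notin> L"
    by (simp_all add: add_divide_distrib)
qed

lemma periodic_L:
  assumes "\<And>z. f (z + 1) = f z" "\<And>z. f (z + \<tau>) = f z" "\<omega> \<in> L"
  shows "f (z + \<omega>) = f z"
proof -
  obtain m n where \<omega>: "\<omega> = of_int m + of_int n * \<tau>"
    using assms(3) unfolding in_L by blast
  have "f (z + (0 + of_int n) * \<tau>) = f (z + 0 * \<tau>)"
  \<comment> \<open>Translation by \<tau> is translation by 1 in the multiple u of \<tau>.\<close>
  proof (rule periodic_of_int[where f = "\<lambda>u. f (z + u * \<tau>)"])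
    show "f (z + (u + 1) * \<tau>) = f (z + u * \<tau>)" for u
      using assms(2)[of "z + u * \<tau>"] by (simp add: algebra_simps)
  qed
  moreover have "f (z + of_int n * \<tau> + of_int m) = f (z + of_int n * \<tau>)"
    by (rule periodic_of_int[of f, OF assms(1)])
  ultimately show ?thesis
    by (simp add: \<omega> add_ac)
qed

lemma wp_periodic: "\<omega> \<in> L \<Longrightarrow> wp (z + \<omega>) = wp z"
  using wp_periodic_aux[OF L_1 half_periods(1)] wp_periodic_aux[OF L_tau half_periods(2)]
  by (rule periodic_L[of wp])

section \<open>Liouville's theorem and the differential equation\<close>

lemma Liouville_periodic:
  assumes "f holomorphic_on UNIV" "\<And>z. f (z + 1) = f z" "\<And>z. f (z + \<tau>) = f z"
  shows "f z = f w"
proof -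
  define P where "P = (\<lambda>(x, y). of_real x + of_real y * \<tau>) ` ({0..1} \<times> {0..1 :: real})"
  have "compact P"
    unfolding P_def by (intro compact_continuous_image compact_Times) (auto intro!: continuous_intros simp: case_prod_unfold)
  then have "bounded (f ` P)"
    by (intro compact_imp_bounded compact_continuous_image holomorphic_on_imp_continuous_on holomorphic_on_subset[OF assms(1)]) auto
  moreover have "range f \<subseteq> f ` P"
  proof safe
    fix z
    define y where "y = Im z / Im \<tau>"
    define x where "x = Re z - y * Re \<tau>"
    have z: "z = of_real x + of_real y * \<tau>"
      using Im_pos by (simp add: complex_eq_iff x_def y_def)
    define u where "u = of_real (frac x) + of_real (frac y) * \<tau>"
    have "z = u + (of_int \<lfloor>x\<rfloor> + of_int \<lfloor>y\<rfloor> * \<tau>)"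
      unfolding z u_def frac_def by (simp add: algebra_simps)
    moreover have "of_int \<lfloor>x\<rfloor> + of_int \<lfloor>y\<rfloor> * \<tau> \<in> L"
      unfolding in_L by blast
    ultimately have "f z = f u"
      using periodic_L[of f, OF assms(2,3)] by simp
    moreover have "u \<in> P"
      unfolding P_def u_def using frac_ge_0 frac_lt_1 by (intro image_eqI[of _ _ "(frac x, frac y)"]) (auto intro: less_imp_le)
    ultimately show "f z \<in> f ` P"
      by simp
  qed
  ultimately have "bounded (range f)"
    by (rule bounded_subset)
  from Liouville_theorem[OF assms(1) this] show ?thesis
    by (auto simp: constant_on_def)
qed

lemma wp_holomorphic: "wp holomorphic_on - L"
  unfolding holomorphic_on_open[OF open_Compl_L(1)] using has_field_derivative_wp by blast

lemma wp'_holomorphic: "wp' holomorphic_on - L"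
proof -
  have "deriv wp holomorphic_on - L"
    by (rule holomorphic_deriv[OF wp_holomorphic open_Compl_L(1)])
  then show ?thesis
    by (rule holomorphic_transform) (simp add: DERIV_imp_deriv[OF has_field_derivative_wp])
qed

lemma eventually_notin_L: "\<forall>\<^sub>F z in at w. z \<notin> L"
proof -
  obtain r where "r > 0" "\<forall>\<omega>\<in>L. \<omega> \<noteq> w \<longrightarrow> r \<le> dist w \<omega>"
    using L_discrete by blast
  then show ?thesis
    unfolding eventually_at by (intro exI[of _ r]) (force simp: dist_commute)
qed

lemma tendsto_at_L:
  assumes "\<And>z. f (z + 1) = f z" "\<And>z. f (z + \<tau>) = f z" "\<omega> \<in> L" "(f \<longlongrightarrow> c) (at (0 :: complex))"
  shows "(f \<longlongrightarrow> c) (at \<omega>)"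
proof -
  have "((\<lambda>z. f (z + - \<omega>)) \<longlongrightarrow> c) (at (0 - - \<omega>))"
    using assms(4) by (rule LIM_offset)
  moreover have "f (z + - \<omega>) = f z" for z
    by (rule periodic_L[of f, OF assms(1,2) L_minus[OF assms(3)]])
  ultimately show ?thesis
    by simp
qed

text \<open>The difference \<open>D\<close> of the two sides is doubly periodic, and near 0 its
  polar part and its constant term cancel. Set to 0 on the lattice, it becomes entire, hence
  constant, and its value at 0 is 0.\<close>

lemma wp_differential_equation:
  assumes "z \<notin> L"
  shows "wp' z ^ 2 = 4 * wp z ^ 3 - 60 * G 4 * wp z - 140 * G 6"
proof -
  define D where "D z = wp' z ^ 2 - 4 * wp z ^ 3 + 60 * G 4 * wp z + 140 * G 6" for z
  define q where "q z = 3 * G 4 + 5 * G 6 * z ^ 2 + z ^ 3 * wp0_rem z" for z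
  define q' where "q' z = 6 * G 4 * z + 20 * G 6 * z ^ 3 + (5 * z ^ 4 * wp0_rem z + z ^ 5 * deriv wp0_rem z)" for z
  \<comment> \<open>What remains of \<open>D\<close> after the cancellation: every summand is
    continuous at 0 and vanishes there.\<close>
  define B where "B z = - 32 * z * wp0_rem z - 4 * z ^ 2 * deriv wp0_rem z + q' z ^ 2 - 12 * z ^ 2 * q z ^ 2
      - 4 * (z ^ 2 * q z) ^ 3 + 60 * G 4 * (z ^ 2 * q z)" for z
  have D1: "D (z + 1) = D z" and D\<tau>: "D (z + \<tau>) = D z" for z
    by (simp_all add: D_def wp'_periodic wp_periodic L_1 L_tau)
  have 0: "0 \<in> - L0"
    by simp
  have rem: "(wp0_rem has_field_derivative deriv wp0_rem z) (at z)" if "z \<in> - L0" for z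
    using wp0_rem_holomorphic open_Compl_L(2) that by (rule holomorphic_derivI)
  have wp0: "wp0 z = z ^ 2 * q z" if "z \<in> - L0" for z
    unfolding wp0_expansion[OF that] q_def by (simp add: eval_nat_numeral algebra_simps)
  have wp0': "deriv wp0 z = q' z" if "z \<in> - L0" for z
  proof -
    have "((\<lambda>z. 3 * G 4 * z ^ 2 + 5 * G 6 * z ^ 4 + z ^ 5 * wp0_rem z) has_field_derivative q' z) (at z)"
      using rem[OF that] unfolding q'_def
      by (auto intro!: derivative_eq_intros simp: algebra_simps)
    then have "(wp0 has_field_derivative q' z) (at z)"
      by (rule has_field_derivative_transform_within_open[OF _ open_Compl_L(2) that]) (simp add: wp0_expansion)
    then show ?thesis
      by (rule DERIV_imp_deriv)
  qed
  have DB: "D z = B z" if "z \<notin> L" for z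
  proof -
    have z: "z \<noteq> 0" "z \<in> - L0"
      using that L_0 by auto
    define R R' where "R = wp0_rem z" and "R' = deriv wp0_rem z"
    \<comment> \<open>With a separate letter for 1 / z, the computation is one with polynomials in i
      and z, reduced by i * z = 1.\<close>
    define i where "i = inverse z"
    have i: "i * z = 1"
      using z by (simp add: i_def)
    have wp: "wp z = i ^ 2 + z ^ 2 * q z"
      using that wp0[OF z(2)] by (simp add: wp_def i_def divide_inverse power_inverse)
    have wp': "wp' z = - 2 * i ^ 3 + q' z"
      using wp'_eq[OF that] wp0'[OF z(2)] by (simp add: i_def divide_inverse power_inverse)
    have "D z = - 4 * (i ^ 3 * q' z) + q' z ^ 2 - 12 * (i ^ 4 * z ^ 2 * q z) - 12 * (i ^ 2 * (z ^ 2 * q z) ^ 2)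
        - 4 * (z ^ 2 * q z) ^ 3 + 60 * G 4 * i ^ 2 + 60 * G 4 * (z ^ 2 * q z) + 140 * G 6"
      unfolding D_def wp wp' by (simp add: eval_nat_numeral algebra_simps)
    also have "i ^ 3 * q' z = 6 * G 4 * i ^ 2 + 20 * G 6 + 5 * z * R + z ^ 2 * R'"
    proof -
      have "i ^ 3 * q' z = 6 * G 4 * (i ^ 2 * (i * z)) + 20 * G 6 * (i * z) ^ 3 + (5 * z * R * (i * z) ^ 3 + z ^ 2 * R' * (i * z) ^ 3)"
        by (simp add: q'_def R_def R'_def eval_nat_numeral algebra_simps)
      then show ?thesis
        by (simp add: i algebra_simps)
    qed
    also have "i ^ 4 * z ^ 2 * q z = 3 * G 4 * i ^ 2 + 5 * G 6 + z * R"
    proof -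
      have "i ^ 4 * z ^ 2 * q z = 3 * G 4 * (i ^ 2 * (i * z) ^ 2) + 5 * G 6 * (i * z) ^ 4 + z * R * (i * z) ^ 4"
        by (simp add: q_def R_def eval_nat_numeral algebra_simps)
      then show ?thesis
        by (simp add: i)
    qed
    also have "i ^ 2 * (z ^ 2 * q z) ^ 2 = z ^ 2 * q z ^ 2"
    proof -
      have "i ^ 2 * (z ^ 2 * q z) ^ 2 = (i * z) ^ 2 * (z ^ 2 * q z ^ 2)"
        by (simp add: eval_nat_numeral algebra_simps)
      then show ?thesis
        by (simp add: i)
    qed
    finally show ?thesis
      by (simp add: B_def R_def R'_def algebra_simps)
  qed
  have cont_rem: "isCont wp0_rem 0" "isCont (deriv wp0_rem) 0"
    using rem[OF 0] holomorphic_derivI[OF holomorphic_deriv[OF wp0_rem_holomorphic open_Compl_L(2)] open_Compl_L(2) 0]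
    by (auto intro: DERIV_isCont)
  then have "isCont B 0"
    unfolding B_def q_def q'_def by (intro continuous_intros)
  then have "(B \<longlongrightarrow> 0) (at 0)"
    unfolding isCont_def by (simp add: B_def q_def q'_def)
  moreover have "\<forall>\<^sub>F z in at 0. B z = D z"
    using eventually_notin_L by eventually_elim (simp add: DB)
  ultimately have D0: "(D \<longlongrightarrow> 0) (at 0)"
    by (rule Lim_transform_eventually)
  have lim: "(D \<longlongrightarrow> 0) (at \<omega>)" if "\<omega> \<in> L" for \<omega>
    by (rule tendsto_at_L[of D, OF D1 D\<tau> that D0])
  have "D holomorphic_on - L"
    unfolding D_def by (intro holomorphic_intros wp_holomorphic wp'_holomorphic)
  from holomorphic_extension[OF this L_discrete lim]
  have "(\<lambda>z. if z \<in> L then 0 else D z) holomorphic_on UNIV" .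
  from Liouville_periodic[OF this, of z 0] have "D z = 0"
    using assms L_0 by (simp add: L_add_iff L_1 L_tau D1 D\<tau>)
  then show ?thesis
    by (simp add: D_def algebra_simps)
qed

lemma wp'_half_period:
  assumes "\<omega> \<in> L" "\<omega> / 2 \<notin> L"
  shows "wp' (\<omega> / 2) = 0"
  using wp'_periodic[OF assms(1), of "- (\<omega> / 2)"] wp'_minus[of "\<omega> / 2"] by simp

lemma wp_cubic_root:
  assumes "\<omega> \<in> L" "\<omega> / 2 \<notin> L"
  shows "4 * wp (\<omega> / 2) ^ 3 - 60 * G 4 * wp (\<omega> / 2) - 140 * G 6 = 0"
  using wp_differential_equation[OF assms(2)] wp'_half_period[OF assms] by simp

section \<open>The product with the square of the odd theta function\<close>

lemma theta1_L: "\<omega> \<in> L \<Longrightarrow> theta1 \<omega> \<tau> = 0"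
  \<comment> \<open>The predicate of being a zero is itself periodic, since the quasi-period factors
    are nonzero.\<close>
  using periodic_L[of "\<lambda>z. theta1 z \<tau> = 0" \<omega> 0] by (simp add: theta1_plus_1 theta1_plus_tau theta1_0)

lemma z_squared_wp: "((\<lambda>z. z ^ 2 * wp z) \<longlongrightarrow> 1) (at 0)"
proof -
  have "isCont wp0 0"
    using has_field_derivative_wp0(2)[of 0] by (intro DERIV_isCont) auto
  then have "((\<lambda>z. 1 + z ^ 2 * wp0 z) \<longlongrightarrow> 1 + 0 ^ 2 * wp0 0) (at 0)"
    unfolding isCont_def by (intro tendsto_intros)
  moreover have "\<forall>\<^sub>F z in at 0. 1 + z ^ 2 * wp0 z = z ^ 2 * wp z"
    using eventually_notin_L
  proof eventually_elim
    case (elim z)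
    then have "z \<noteq> 0"
      using L_0 by auto
    then show ?case
      using elim by (simp add: wp_def distrib_left)
  qed
  ultimately show ?thesis
    by (simp add: Lim_transform_eventually)
qed

text \<open>At a lattice point \<omega> the double pole of \<open>wp\<close>, with leading
  coefficient 1, meets the zero of \<open>theta1\<close>; the value prescribed there is the limit of
  the product.\<close>

definition theta_wp :: "complex \<Rightarrow> complex" where
  "theta_wp z = (if z \<in> L then deriv (\<lambda>z. theta1 z \<tau>) z ^ 2 else theta1 z \<tau> ^ 2 * wp z)"

lemma theta_wp_holomorphic: "theta_wp holomorphic_on UNIV"
proof -
  have hol: "(\<lambda>z. theta1 z \<tau> ^ 2 * wp z) holomorphic_on - L"
    by (intro holomorphic_intros wp_holomorphic Im_pos)
  have lim: "((\<lambda>z. theta1 z \<tau> ^ 2 * wp z) \<longlongrightarrow> deriv (\<lambda>z. theta1 z \<tau>) \<omega> ^ 2) (at \<omega>)" if \<omega>: "\<omega> \<in> L" for \<omega>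
  proof -
    have "((\<lambda>z. (theta1 z \<tau> - theta1 \<omega> \<tau>) / (z - \<omega>)) \<longlongrightarrow> deriv (\<lambda>z. theta1 z \<tau>) \<omega>) (at \<omega>)"
      using has_field_derivative_theta1[OF Im_pos, of \<omega>] unfolding has_field_derivative_iff .
    moreover have "((\<lambda>z. (z + - \<omega>) ^ 2 * wp (z + - \<omega>)) \<longlongrightarrow> 1) (at (0 - - \<omega>))"
      using z_squared_wp by (rule LIM_offset)
    ultimately have "((\<lambda>z. ((theta1 z \<tau> - theta1 \<omega> \<tau>) / (z - \<omega>)) ^ 2 * ((z + - \<omega>) ^ 2 * wp (z + - \<omega>))) \<longlongrightarrow>
        deriv (\<lambda>z. theta1 z \<tau>) \<omega> ^ 2 * 1) (at \<omega>)"
      by (intro tendsto_intros) simp_all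
    moreover have "\<forall>\<^sub>F z in at \<omega>. ((theta1 z \<tau> - theta1 \<omega> \<tau>) / (z - \<omega>)) ^ 2 * ((z + - \<omega>) ^ 2 * wp (z + - \<omega>)) = theta1 z \<tau> ^ 2 * wp z"
      using eventually_neq_at_within[of \<omega>]
    proof eventually_elim
      case (elim z)
      have "wp (z + - \<omega>) = wp z"
        using \<omega> by (intro wp_periodic) (simp add: L_minus)
      then show ?case
        using elim theta1_L[OF \<omega>] by (simp add: power_divide)
    qed
    ultimately show ?thesis
      by (simp add: Lim_transform_eventually)
  qed
  show ?thesis
    using holomorphic_extension[OF hol L_discrete lim] by (simp add: theta_wp_def[abs_def])
qed

lemma theta_wp_in_theta_space: "theta_wp \<in> theta_space \<tau>"
proof -
  define E where "E z = exp (- of_real pi * \<i> * \<tau> - 2 * of_real pi * \<i> * z)" for z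
  have E2: "E z ^ 2 = exp (- (2 * of_real pi * \<i> * \<tau>)) * exp (- (2 * of_real pi * \<i> * of_int 2 * z))" for z
    unfolding E_def power2_eq_square exp_add[symmetric] by (simp add: algebra_simps)
  have th: "((\<lambda>z. theta1 z \<tau>) has_field_derivative deriv (\<lambda>z. theta1 z \<tau>) z) (at z)" for z
    by (rule has_field_derivative_theta1[OF Im_pos])
  have d1: "deriv (\<lambda>z. theta1 z \<tau>) (z + 1) = - deriv (\<lambda>z. theta1 z \<tau>) z" for z
  proof -
    have "((\<lambda>z. theta1 (z + 1) \<tau>) has_field_derivative deriv (\<lambda>z. theta1 z \<tau>) (z + 1)) (at z)"
      using th[of "z + 1"] by (simp add: DERIV_shift)
    moreover have "((\<lambda>z. theta1 (z + 1) \<tau>) has_field_derivative - deriv (\<lambda>z. theta1 z \<tau>) z) (at z)"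
      unfolding theta1_plus_1 by (rule DERIV_minus[OF th])
    ultimately show ?thesis
      by (rule DERIV_unique)
  qed
  \<comment> \<open>On the lattice the value is given by the derivative, whose transformation must
    be checked separately. The term from differentiating the exponential factor disappears there
    because \<open>theta1\<close> vanishes.\<close>
  have d\<tau>: "deriv (\<lambda>z. theta1 z \<tau>) (z + \<tau>) = - E z * deriv (\<lambda>z. theta1 z \<tau>) z" if "z \<in> L" for z
  proof -
    have "((\<lambda>z. theta1 (z + \<tau>) \<tau>) has_field_derivative deriv (\<lambda>z. theta1 z \<tau>) (z + \<tau>)) (at z)"
      using th[of "z + \<tau>"] by (simp add: DERIV_shift)
    moreover have "(E has_field_derivative - 2 * of_real pi * \<i> * E z) (at z)"
      unfolding E_def by (auto intro!: derivative_eq_intros)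
    from DERIV_mult[OF DERIV_minus[OF this] th]
    have "((\<lambda>z. theta1 (z + \<tau>) \<tau>) has_field_derivative - E z * deriv (\<lambda>z. theta1 z \<tau>) z) (at z)"
      unfolding theta1_plus_tau E_def[symmetric] by (simp add: theta1_L[OF that] mult.commute)
    ultimately show ?thesis
      by (rule DERIV_unique)
  qed
  have "theta_wp (z + 1) = theta_wp z" for z
    by (simp add: theta_wp_def L_add_iff L_1 d1 theta1_plus_1 wp_periodic)
  moreover have "theta_wp (z + \<tau>) = E z ^ 2 * theta_wp z" for z
  proof -
    have "theta1 (z + \<tau>) \<tau> = - E z * theta1 z \<tau>"
      unfolding theta1_plus_tau E_def ..
    then show ?thesis
      by (simp add: theta_wp_def L_add_iff L_tau d\<tau> wp_periodic power_mult_distrib)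
  qed
  ultimately show ?thesis
    unfolding theta_space_def E2 using theta_wp_holomorphic by blast
qed

end

section \<open>Half-period values and theta constants\<close>

text \<open>Subtracting two of the equations and dividing by the difference of the roots gives a
  quadratic relation; subtracting two such relations gives the zero sum. The coefficients are
  expressed by e3 and e1 - e2 to match the entries of the determinant.\<close>

lemma cubic_coefficients:
  fixes e1 e2 e3 g h :: "'a::{idom, ring_char_0}"
  assumes "4 * e1 ^ 3 - g * e1 - h = 0" "4 * e2 ^ 3 - g * e2 - h = 0" "4 * e3 ^ 3 - g * e3 - h = 0"
    and "e1 \<noteq> e2" "e1 \<noteq> e3" "e2 \<noteq> e3"
  shows "e1 + e2 + e3 = 0" "g = 3 * e3 ^ 2 + (e1 - e2) ^ 2" "h = e3 ^ 3 - (e1 - e2) ^ 2 * e3"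
proof -
  have quot: "4 * (x ^ 2 + x * y + y ^ 2) = g"
    if "4 * x ^ 3 - g * x - h = 0" "4 * y ^ 3 - g * y - h = 0" "x \<noteq> y" for x y
  proof -
    have "(x - y) * (4 * (x ^ 2 + x * y + y ^ 2) - g) = (4 * x ^ 3 - g * x - h) - (4 * y ^ 3 - g * y - h)"
      by (simp add: eval_nat_numeral algebra_simps)
    also have "\<dots> = 0"
      by (simp only: that diff_self)
    finally show ?thesis
      using \<open>x \<noteq> y\<close> by simp
  qed
  have 12: "4 * (e1 ^ 2 + e1 * e2 + e2 ^ 2) = g" and 13: "4 * (e1 ^ 2 + e1 * e3 + e3 ^ 2) = g"
    using quot assms by blast+
  have "4 * ((e2 - e3) * (e1 + e2 + e3)) = 4 * (e1 ^ 2 + e1 * e2 + e2 ^ 2) - 4 * (e1 ^ 2 + e1 * e3 + e3 ^ 2)"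
    by (simp add: eval_nat_numeral algebra_simps)
  also have "\<dots> = 0"
    by (simp only: 12 13 diff_self)
  finally show sum: "e1 + e2 + e3 = 0"
    using assms(6) by simp
  then have e3: "e3 = - (e1 + e2)"
    by (metis add.commute add_eq_0_iff)
  show g: "g = 3 * e3 ^ 2 + (e1 - e2) ^ 2"
    unfolding 12[symmetric] e3 by (simp add: eval_nat_numeral algebra_simps)
  have "h = 4 * e3 ^ 3 - g * e3"
    using assms(3) by simp
  then show "h = e3 ^ 3 - (e1 - e2) ^ 2 * e3"
    unfolding g by (simp add: eval_nat_numeral algebra_simps)
qed

context normalized_lattice
begin

section \<open>Values at the half periods\<close>

lemma Im_double: "Im (2 * \<tau>) > 0"
  using Im_pos by simp

lemma theta_space_basis:
  "(\<lambda>z. theta3 (2 * z) (2 * \<tau>)) \<in> theta_space \<tau>" "(\<lambda>z. theta2 (2 * z) (2 * \<tau>)) \<in> theta_space \<tau>"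
proof -
  have 1: "2 * (z + 1) = 2 * z + 1 + 1" and 2: "2 * (z + \<tau>) = 2 * z + 2 * \<tau>" for z :: complex
    by simp_all
  have E: "exp (- of_real pi * \<i> * (2 * \<tau>) - 2 * of_real pi * \<i> * (2 * z)) =
      exp (- (2 * of_real pi * \<i> * \<tau>)) * exp (- (2 * of_real pi * \<i> * of_int 2 * z))" for z
    unfolding exp_add[symmetric] by (simp add: algebra_simps)
  have "theta3 (2 * (z + 1)) (2 * \<tau>) = theta3 (2 * z) (2 * \<tau>)"
    "theta2 (2 * (z + 1)) (2 * \<tau>) = theta2 (2 * z) (2 * \<tau>)" for z
    unfolding 1 theta3_plus_1 theta2_plus_1 by simp_all
  moreover have "theta3 (2 * (z + \<tau>)) (2 * \<tau>) =
      exp (- (2 * of_real pi * \<i> * \<tau>)) * exp (- (2 * of_real pi * \<i> * of_int 2 * z)) * theta3 (2 * z) (2 * \<tau>)"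
    "theta2 (2 * (z + \<tau>)) (2 * \<tau>) =
      exp (- (2 * of_real pi * \<i> * \<tau>)) * exp (- (2 * of_real pi * \<i> * of_int 2 * z)) * theta2 (2 * z) (2 * \<tau>)" for z
    unfolding 2 theta3_plus_tau theta2_plus_tau E by simp_all
  moreover have "(\<lambda>z. theta3 (2 * z) (2 * \<tau>)) holomorphic_on UNIV" "(\<lambda>z. theta2 (2 * z) (2 * \<tau>)) holomorphic_on UNIV"
    by (intro holomorphic_intros Im_double)+
  ultimately show "(\<lambda>z. theta3 (2 * z) (2 * \<tau>)) \<in> theta_space \<tau>" "(\<lambda>z. theta2 (2 * z) (2 * \<tau>)) \<in> theta_space \<tau>"
    unfolding theta_space_def by blast+
qed

lemma wp_half_period_differences:
  "wp (1 / 2) - wp ((1 + \<tau>) / 2) = of_real pi ^ 2 * theta4 0 \<tau> ^ 4"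
  "wp (1 / 2) - wp (\<tau> / 2) = of_real pi ^ 2 * theta3 0 \<tau> ^ 4"
  "wp ((1 + \<tau>) / 2) - wp (\<tau> / 2) = of_real pi ^ 2 * theta2 0 \<tau> ^ 4"
proof -
  define a b where "a = theta3 0 (2 * \<tau>)" and "b = theta2 0 (2 * \<tau>)"
  define A B where "A z = theta3 (2 * z) (2 * \<tau>)" and "B z = theta2 (2 * z) (2 * \<tau>)" for z
  define e1 e2 e3 where "e1 = wp (1 / 2)" and "e2 = wp ((1 + \<tau>) / 2)" and "e3 = wp (\<tau> / 2)"
  define t2 t3 t4 where "t2 = theta2 0 \<tau>" and "t3 = theta3 0 \<tau>" and "t4 = theta4 0 \<tau>"
  \<comment> \<open>The factor of the translation by \<tau>, half a quasi-period of 2\<tau>,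
    starting at 0. It is common to both basis functions and cancels from each equation; starting at
    1 only changes its sign.\<close>
  define \<kappa> where "\<kappa> = exp (- of_real pi * \<i> * (2 * \<tau>) / 4)"
  have \<kappa>: "\<kappa> \<noteq> 0"
    by (simp add: \<kappa>_def)
  have nz: "a \<noteq> 0" "b \<noteq> 0"
    using theta_nonzero_deriv_theta1[OF Im_double] by (simp_all add: a_def b_def)
  have t: "t2 \<noteq> 0" "t3 \<noteq> 0" "t4 \<noteq> 0" "deriv (\<lambda>z. theta1 z \<tau>) 0 = of_real pi * \<i> * t2 * t3 * t4"
    unfolding t2_def t3_def t4_def by (rule theta_nonzero_deriv_theta1[OF Im_pos])+
  have sq: "t2 ^ 2 = 2 * a * b" "t3 ^ 2 = a ^ 2 + b ^ 2" "t4 ^ 2 = a ^ 2 - b ^ 2"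
    using theta2_0_square[OF Im_pos] theta3_0_square[OF Im_pos] theta4_0_square[OF Im_pos]
    by (simp_all add: t2_def t3_def t4_def a_def b_def)
  have AB0: "A 0 = a" "B 0 = b"
    by (simp_all add: A_def B_def a_def b_def)
  have AB1: "A (1 / 2) = a" "B (1 / 2) = - b"
    using theta3_plus_1[of 0] theta2_plus_1[of 0] by (simp_all add: A_def B_def a_def b_def)
  have AB\<tau>: "A (\<tau> / 2) = \<kappa> * b" "B (\<tau> / 2) = \<kappa> * a"
    using theta3_plus_half_tau[of 0 "2 * \<tau>"] theta2_plus_half_tau[of 0 "2 * \<tau>"]
    by (simp_all add: A_def B_def a_def b_def \<kappa>_def)
  have "exp (- of_real pi * \<i> * (2 * \<tau>) / 4 - of_real pi * \<i> * 1) = - \<kappa>"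
    using exp_minus[of "of_real pi * \<i>"] unfolding \<kappa>_def exp_diff by simp
  then have AB1\<tau>: "A ((1 + \<tau>) / 2) = \<kappa> * b" "B ((1 + \<tau>) / 2) = - \<kappa> * a"
    using theta3_plus_half_tau[of 1 "2 * \<tau>"] theta2_plus_half_tau[of 1 "2 * \<tau>"]
      theta3_plus_1[of 0 "2 * \<tau>"] theta2_plus_1[of 0 "2 * \<tau>"]
    by (simp_all add: A_def B_def a_def b_def)
  have indep: "\<alpha> = 0 \<and> \<beta> = 0" if "\<And>z. \<alpha> * A z + \<beta> * B z = 0" for \<alpha> \<beta>
  proof -
    \<comment> \<open>The values at 0 and 1/2 are (a, b) and (a, -b), which are independent because
      a and b are nonzero.\<close>
    have *: "\<alpha> * a + \<beta> * b = 0" "\<alpha> * a - \<beta> * b = 0"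
      using that[of 0] that[of "1 / 2"] by (simp_all add: AB0 AB1)
    have "2 * (\<alpha> * a) = (\<alpha> * a + \<beta> * b) + (\<alpha> * a - \<beta> * b)"
      "2 * (\<beta> * b) = (\<alpha> * a + \<beta> * b) - (\<alpha> * a - \<beta> * b)"
      by simp_all
    then have "2 * (\<alpha> * a) = 0" "2 * (\<beta> * b) = 0"
      unfolding * by simp_all
    then show ?thesis
      using nz by simp
  qed
  obtain \<alpha> \<beta> where span: "\<And>z. theta_wp z = \<alpha> * A z + \<beta> * B z"
    using theta_space_span[OF theta_wp_in_theta_space theta_space_basis[folded A_def B_def] indep] by blast
  have theta1_sq: "theta1 z \<tau> ^ 2 = a * B z - b * A z" for z
    using theta1_square[OF Im_pos] by (simp add: a_def b_def A_def B_def)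
  have wp: "(a * B z - b * A z) * wp z = \<alpha> * A z + \<beta> * B z" if "z \<notin> L" for z
    using span[of z] that by (simp add: theta_wp_def theta1_sq)
  \<comment> \<open>At 0 the product takes the value of the squared derivative, known from Jacobi's
    formula. The factor \<i> in this normalization of the odd theta function is the origin of the
    minus sign in \<open>E\<close>.\<close>
  have "\<alpha> * a + \<beta> * b = (of_real pi * \<i> * t2 * t3 * t4) ^ 2"
    using span[of 0] L_0 by (simp add: theta_wp_def AB0 t(4))
  then have E: "\<alpha> * a + \<beta> * b = - (of_real pi ^ 2 * t2 ^ 2 * t3 ^ 2 * t4 ^ 2)"
    by (simp add: power_mult_distrib)
  have e1: "e1 * t2 ^ 2 = - (\<alpha> * a - \<beta> * b)"
    using wp[OF half_periods(1)] unfolding AB1 e1_def[symmetric] sq by (simp add: algebra_simps)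
  have "\<kappa> * (e3 * t4 ^ 2) = \<kappa> * (\<alpha> * b + \<beta> * a)"
    using wp[OF half_periods(2)] unfolding AB\<tau> e3_def[symmetric] sq by (simp add: power2_eq_square algebra_simps)
  then have e3: "e3 * t4 ^ 2 = \<alpha> * b + \<beta> * a"
    using \<kappa> by simp
  have "\<kappa> * (e2 * t3 ^ 2) = \<kappa> * (- (\<alpha> * b - \<beta> * a))"
    using wp[OF half_periods(3)] unfolding AB1\<tau> e2_def[symmetric] sq by (simp add: power2_eq_square algebra_simps)
  then have e2: "e2 * t3 ^ 2 = - (\<alpha> * b - \<beta> * a)"
    using \<kappa> by simp
  \<comment> \<open>Clearing denominators leaves a combination of two linear forms in \<alpha>,
    \<beta>. After \<open>sq\<close> rewrites the theta squares in a and b, it factors as -(\<alpha>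
    a + \<beta> b) times the third square. The other two differences follow the same
    pattern.\<close>
  have "(t2 ^ 2 * t3 ^ 2) * (e1 - e2) = (e1 * t2 ^ 2) * t3 ^ 2 - (e2 * t3 ^ 2) * t2 ^ 2"
    by (simp add: algebra_simps)
  also have "\<dots> = - (\<alpha> * a + \<beta> * b) * t4 ^ 2"
    unfolding e1 e2 unfolding sq by (simp add: power2_eq_square algebra_simps)
  also have "\<dots> = (t2 ^ 2 * t3 ^ 2) * (of_real pi ^ 2 * t4 ^ 4)"
    unfolding E by (simp add: eval_nat_numeral)
  finally show "wp (1 / 2) - wp ((1 + \<tau>) / 2) = of_real pi ^ 2 * theta4 0 \<tau> ^ 4"
    using t by (simp add: e1_def e2_def t4_def)
  have "(t2 ^ 2 * t4 ^ 2) * (e1 - e3) = (e1 * t2 ^ 2) * t4 ^ 2 - (e3 * t4 ^ 2) * t2 ^ 2"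
    by (simp add: algebra_simps)
  also have "\<dots> = - (\<alpha> * a + \<beta> * b) * t3 ^ 2"
    unfolding e1 e3 unfolding sq by (simp add: power2_eq_square algebra_simps)
  also have "\<dots> = (t2 ^ 2 * t4 ^ 2) * (of_real pi ^ 2 * t3 ^ 4)"
    unfolding E by (simp add: eval_nat_numeral)
  finally show "wp (1 / 2) - wp (\<tau> / 2) = of_real pi ^ 2 * theta3 0 \<tau> ^ 4"
    using t by (simp add: e1_def e3_def t3_def)
  have "(t3 ^ 2 * t4 ^ 2) * (e2 - e3) = (e2 * t3 ^ 2) * t4 ^ 2 - (e3 * t4 ^ 2) * t3 ^ 2"
    by (simp add: algebra_simps)
  also have "\<dots> = - (\<alpha> * a + \<beta> * b) * t2 ^ 2"
    unfolding e2 e3 unfolding sq by (simp add: power2_eq_square algebra_simps)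
  also have "\<dots> = (t3 ^ 2 * t4 ^ 2) * (of_real pi ^ 2 * t2 ^ 4)"
    unfolding E by (simp add: eval_nat_numeral)
  finally show "wp ((1 + \<tau>) / 2) - wp (\<tau> / 2) = of_real pi ^ 2 * theta2 0 \<tau> ^ 4"
    using t by (simp add: e2_def e3_def t2_def)
qed

text \<open>Nonvanishing of the theta constants makes the three half-period values distinct, so they
  are all the roots of the cubic and determine its coefficients.\<close>

lemma eisenstein_theta:
  defines "e \<equiv> of_real pi ^ 2 / 3 * (theta2 0 \<tau> ^ 4 + theta3 0 \<tau> ^ 4)"
  shows "60 * G 4 = 3 * e ^ 2 + of_real pi ^ 4 * theta4 0 \<tau> ^ 8"
    and "140 * G 6 = of_real pi ^ 4 * theta4 0 \<tau> ^ 8 * e - e ^ 3"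
proof -
  define e1 e2 e3 where "e1 = wp (1 / 2)" and "e2 = wp ((1 + \<tau>) / 2)" and "e3 = wp (\<tau> / 2)"
  note d = wp_half_period_differences[folded e1_def e2_def e3_def]
  note nz = theta_nonzero_deriv_theta1(1-3)[OF Im_pos]
  have "e1 - e2 \<noteq> 0" "e1 - e3 \<noteq> 0" "e2 - e3 \<noteq> 0"
    unfolding d using nz by simp_all
  then have ne: "e1 \<noteq> e2" "e1 \<noteq> e3" "e2 \<noteq> e3"
    by auto
  note root = wp_cubic_root[OF L_1 half_periods(1), folded e1_def]
    wp_cubic_root[OF L_add[OF L_1 L_tau] half_periods(3), folded e2_def]
    wp_cubic_root[OF L_tau half_periods(2), folded e3_def]
  note c = cubic_coefficients[OF root ne]
  \<comment> \<open>The zero sum turns the two differences with e3 into e3 itself; this is where the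
    third and the sum of fourth powers in e come from.\<close>
  have "3 * e3 = (e1 + e2 + e3) - ((e1 - e3) + (e2 - e3))"
    by simp
  also have "\<dots> = - 3 * e"
    unfolding c(1) d(2,3) e_def by (simp add: algebra_simps)
  finally have e3: "e3 = - e"
    by simp
  have 8: "(e1 - e2) ^ 2 = of_real pi ^ 4 * theta4 0 \<tau> ^ 8"
    unfolding d(1) by (simp add: power_mult_distrib flip: power_mult)
  show "60 * G 4 = 3 * e ^ 2 + of_real pi ^ 4 * theta4 0 \<tau> ^ 8"
    unfolding c(2) 8 e3 by simp
  show "140 * G 6 = of_real pi ^ 4 * theta4 0 \<tau> ^ 8 * e - e ^ 3"
    unfolding c(3) 8 e3 by simp
qed

end

section \<open>Scaling to an arbitrary lattice\<close>

lemma infsum_period_lattice_scale: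
  assumes "\<omega>1 \<noteq> 0"
  shows "(\<Sum>\<^sub>\<infinity>\<omega>\<in>period_lattice \<omega>1 \<omega>2 - {0}. 1 / \<omega> ^ k) =
           1 / \<omega>1 ^ k * (\<Sum>\<^sub>\<infinity>\<omega>\<in>period_lattice 1 (\<omega>2 / \<omega>1) - {0}. 1 / \<omega> ^ k)"
proof -
  have mem: "\<omega>1 * \<omega> \<in> period_lattice \<omega>1 \<omega>2 \<longleftrightarrow> \<omega> \<in> period_lattice 1 (\<omega>2 / \<omega>1)" for \<omega>
  proof -
    have "\<omega>1 * \<omega> = of_int m * \<omega>1 + of_int n * \<omega>2 \<longleftrightarrow> \<omega> = of_int m * 1 + of_int n * (\<omega>2 / \<omega>1)" for m n
    proof -
      have "of_int m * \<omega>1 + of_int n * \<omega>2 = \<omega>1 * (of_int m * 1 + of_int n * (\<omega>2 / \<omega>1))"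
        using assms by (simp add: distrib_left)
      then show ?thesis
        using assms by simp
    qed
    then show ?thesis
      by (simp add: period_lattice_def)
  qed
  have "(\<Sum>\<^sub>\<infinity>\<omega>\<in>period_lattice \<omega>1 \<omega>2 - {0}. 1 / \<omega> ^ k) =
      (\<Sum>\<^sub>\<infinity>\<omega>\<in>period_lattice 1 (\<omega>2 / \<omega>1) - {0}. 1 / \<omega>1 ^ k * (1 / \<omega> ^ k))"
  proof (rule infsum_reindex_bij_witness[of _ "\<lambda>\<omega>. \<omega>1 * \<omega>" "\<lambda>\<omega>. \<omega> / \<omega>1"])
    fix \<omega> assume "\<omega> \<in> period_lattice \<omega>1 \<omega>2 - {0}"
    then show "\<omega> / \<omega>1 \<in> period_lattice 1 (\<omega>2 / \<omega>1) - {0}"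
      using mem[of "\<omega> / \<omega>1"] assms by simp
  qed (use assms mem in \<open>auto simp: power_divide\<close>)
  then show ?thesis
    by (simp only: infsum_cmult_right')
qed

lemma weierstrass_cubic_theta:
  fixes \<omega>1 \<omega>2 :: complex
  assumes "Im (\<omega>2 / \<omega>1) > 0"
  defines "\<tau> \<equiv> \<omega>2 / \<omega>1"
  defines "e \<equiv> of_real pi ^ 2 / (3 * \<omega>1 ^ 2) * (theta2 0 \<tau> ^ 4 + theta3 0 \<tau> ^ 4)"
    and "C \<equiv> (of_real pi / \<omega>1) ^ 4 * theta4 0 \<tau> ^ 8"
  shows "lattice_g2 (period_lattice \<omega>1 \<omega>2) = 3 * e ^ 2 + C"
    and "lattice_g3 (period_lattice \<omega>1 \<omega>2) = C * e - e ^ 3"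
proof -
  interpret normalized_lattice \<tau>
    by unfold_locales (use assms(1) in \<open>simp add: \<tau>_def\<close>)
  have \<omega>1: "\<omega>1 \<noteq> 0"
    using assms(1) by auto
  define e' where "e' = of_real pi ^ 2 / 3 * (theta2 0 \<tau> ^ 4 + theta3 0 \<tau> ^ 4)"
  have e: "e = e' / \<omega>1 ^ 2"
    by (simp add: e_def e'_def)
  have C: "C = of_real pi ^ 4 * theta4 0 \<tau> ^ 8 / \<omega>1 ^ 4"
    by (simp add: C_def power_divide)
  note G = eisenstein_theta[folded e'_def]
  have "lattice_g2 (period_lattice \<omega>1 \<omega>2) = (60 * G 4) / \<omega>1 ^ 4"
    unfolding lattice_g2_def infsum_period_lattice_scale[OF \<omega>1] G_def \<tau>_def[symmetric] by simp
  also have "\<dots> = 3 * e ^ 2 + C"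
    unfolding G e C by (simp add: add_divide_distrib power_divide flip: power_mult)
  finally show "lattice_g2 (period_lattice \<omega>1 \<omega>2) = 3 * e ^ 2 + C" .
  have "lattice_g3 (period_lattice \<omega>1 \<omega>2) = (140 * G 6) / \<omega>1 ^ 6"
    unfolding lattice_g3_def infsum_period_lattice_scale[OF \<omega>1] G_def \<tau>_def[symmetric] by simp
  also have "\<dots> = C * e - e ^ 3"
    unfolding G e C by (simp add: diff_divide_distrib power_divide flip: power_mult power_add)
  finally show "lattice_g3 (period_lattice \<omega>1 \<omega>2) = C * e - e ^ 3" .
qed

theorem theorem1p1:
  shows
    "(\<forall>g2 g3 :: 'a::field.
        defines_smooth_plane_curve (weierstrass_cubic g2 g3) \<longrightarrow>
        (\<forall>t d :: 'a alg_closure.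
           d ^ 2 = 4 * t ^ 3 - to_ac g2 * t - to_ac g3 \<longrightarrow>
           extend_to_closure (weierstrass_cubic g2 g3) =
             det (vector
               [vector [2 * \<x> + Const t * \<z>, \<y> + Const d * \<z>, Const (3 * t ^ 2 - to_ac g2) * \<z>],
                vector [0,                   \<x> - Const t * \<z>, \<y> - Const d * \<z>],
                vector [\<z>,                   0,               - 2 * \<x> - Const t * \<z>]]
               :: 'a alg_closure poly3 ^ 3 ^ 3)))
     \<and>
     (\<forall>g2 g3 \<omega>1 \<omega>2 :: complex.
        defines_smooth_plane_curve (weierstrass_cubic g2 g3) \<longrightarrow>
        Im (\<omega>2 / \<omega>1) > 0 \<longrightarrow>
        g2 = lattice_g2 (period_lattice \<omega>1 \<omega>2) \<longrightarrow>
        g3 = lattice_g3 (period_lattice \<omega>1 \<omega>2) \<longrightarrow>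
        (let \<tau> = \<omega>2 / \<omega>1;
             a = theta2 0 \<tau>;
             b = theta3 0 \<tau>;
             c = theta4 0 \<tau>;
             e = of_real pi ^ 2 / (3 * \<omega>1 ^ 2) * (a ^ 4 + b ^ 4)
         in
           weierstrass_cubic g2 g3 =
             det (vector
               [vector [2 * \<x> - Const e * \<z>, \<y>,               - Const ((of_real pi / \<omega>1) ^ 4 * c ^ 8) * \<z>],
                vector [0,                   \<x> + Const e * \<z>, \<y>],
                vector [\<z>,                   0,               - 2 * \<x> + Const e * \<z>]]
               :: complex poly3 ^ 3 ^ 3)))"
proof (rule conjI; intro allI impI)
  fix g2 g3 :: 'a and t d :: "'a alg_closure"
  assume "d ^ 2 = 4 * t ^ 3 - to_ac g2 * t - to_ac g3"
  then show "extend_to_closure (weierstrass_cubic g2 g3) =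
      det (vector
        [vector [2 * \<x> + Const t * \<z>, \<y> + Const d * \<z>, Const (3 * t ^ 2 - to_ac g2) * \<z>],
         vector [0,                   \<x> - Const t * \<z>, \<y> - Const d * \<z>],
         vector [\<z>,                   0,               - 2 * \<x> - Const t * \<z>]]
        :: 'a alg_closure poly3 ^ 3 ^ 3)"
    unfolding extend_to_closure_weierstrass by (rule weierstrass_cubic_det)
next
  fix g2 g3 \<omega>1 \<omega>2 :: complex
  assume Im: "Im (\<omega>2 / \<omega>1) > 0"
    and g2: "g2 = lattice_g2 (period_lattice \<omega>1 \<omega>2)" and g3: "g3 = lattice_g3 (period_lattice \<omega>1 \<omega>2)"
  define e where "e = of_real pi ^ 2 / (3 * \<omega>1 ^ 2) * (theta2 0 (\<omega>2 / \<omega>1) ^ 4 + theta3 0 (\<omega>2 / \<omega>1) ^ 4)"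
  define C where "C = (of_real pi / \<omega>1) ^ 4 * theta4 0 (\<omega>2 / \<omega>1) ^ 8"
  note g = weierstrass_cubic_theta[OF Im, folded e_def C_def g2 g3]
  \<comment> \<open>The first identity is applied at the point (-e, 0), a point of order two on the
    curve: -e is the rescaled value at the half period \<tau>/2.\<close>
  have "0 ^ 2 = 4 * (- e) ^ 3 - g2 * (- e) - g3"
    unfolding g by (simp add: eval_nat_numeral algebra_simps)
  note det = weierstrass_cubic_det[OF this]
  have "3 * (- e) ^ 2 - g2 = - C"
    unfolding g by simp
  moreover have "Const 0 = (0 :: complex poly3)"
    by (simp add: Const_def)
  ultimately show "let \<tau> = \<omega>2 / \<omega>1; a = theta2 0 \<tau>; b = theta3 0 \<tau>; c = theta4 0 \<tau>;
      e = of_real pi ^ 2 / (3 * \<omega>1 ^ 2) * (a ^ 4 + b ^ 4)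
    in weierstrass_cubic g2 g3 =
      det (vector
        [vector [2 * \<x> - Const e * \<z>, \<y>,               - Const ((of_real pi / \<omega>1) ^ 4 * c ^ 8) * \<z>],
         vector [0,                   \<x> + Const e * \<z>, \<y>],
         vector [\<z>,                   0,               - 2 * \<x> + Const e * \<z>]]
        :: complex poly3 ^ 3 ^ 3)"
    using det unfolding Let_def e_def[symmetric] C_def[symmetric]
    by (simp only: Const_minus mult_minus_left add_uminus_conv_diff diff_minus_eq_add
        mult_zero_left add_0_right diff_0_right)
qed

end
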